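(* Let $0<\beta<\infty$, $u\in H(\mathbb{D})$, $\varphi\in S(\mathbb{D})$, and suppose $uC_\varphi:\mathcal{B}\to\mathcal{Z}_\beta$ is bounded. Then $$\|uC_\varphi\|_{e,\mathcal{B}\to\mathcal{Z}_\beta}\asymp\max\Big\{\limsup_{n\to\infty}(n+1)\|(2u'\varphi'+u\varphi'')\varphi^n\|_{\nu_\beta},\ \limsup_{n\to\infty}(n+1)^{2}\|u(\varphi')^2\varphi^n\|_{\nu_\beta},\ \limsup_{n\to\infty}(\log n)\|u''\varphi^n\|_{\nu_\beta}\Big\}.$$
   Context: $\mathbb{D}$ is the open unit disk, $H(\mathbb{D})$ the holomorphic functions on $\mathbb{D}$, $S(\mathbb{D})$ the holomorphic self-maps of $\mathbb{D}$; $uC_\varphi f(z)=u(z)f(\varphi(z))$, and $\varphi^n$ is the $n$-th power of $\varphi$. $\mathcal{B}$ is the Bloch space of $f\in H(\mathbb{D})$ with $\sup_z(1-|z|^2)|f'(z)|<\infty$, normed by $|f(0)|+\sup_z(1-|z|^2)|f'(z)|$. $\mathcal{Z}_\beta$ is the space of $f\in H(\mathbb{D})$ with $\sup_z(1-|z|^2)^\beta|f''(z)|<\infty$, normed by $|f(0)|+|f'(0)|+\sup_z(1-|z|^2)^\beta|f''(z)|$. For $g\in H(\mathbb{D})$, $\|g\|_{\nu_\beta}=\sup_z(1-|z|^2)^\beta|g(z)|$. The essential norm of a bounded operator $T:X\to Y$ is $\inf\{\|T-K\|:K:X\to Y\text{ compact}\}$. $A\asymp B$ means $B/C\le A\le CB$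 for a positive constant $C$ independent of $u,\varphi$. *)

theory Defs
  imports "HOL-Analysis.Analysis"
begin

abbreviation disc :: "complex set" where "disc \<equiv> ball 0 1"

definition self_map :: "(complex \<Rightarrow> complex) \<Rightarrow> bool" where
  "self_map \<phi> \<longleftrightarrow> \<phi> holomorphic_on disc \<and> \<phi> ` disc \<subseteq> disc"

definition wcomp :: "(complex \<Rightarrow> complex) \<Rightarrow> (complex \<Rightarrow> complex) \<Rightarrow> (complex \<Rightarrow> complex) \<Rightarrow> (complex \<Rightarrow> complex)" where
  "wcomp u \<phi> f = (\<lambda>z. u z * f (\<phi> z))"

definition bloch :: "(complex \<Rightarrow> complex) set" where
  "bloch = {f. f holomorphic_on disc \<and>
     bdd_above ((\<lambda>z. (1 - norm z ^ 2) * norm (deriv f z)) ` disc)}"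

definition bloch_norm :: "(complex \<Rightarrow> complex) \<Rightarrow> real" where
  "bloch_norm f = norm (f 0) + (SUP z\<in>disc. (1 - norm z ^ 2) * norm (deriv f z))"

definition zyg :: "real \<Rightarrow> (complex \<Rightarrow> complex) set" where
  "zyg \<beta> = {f. f holomorphic_on disc \<and>
     bdd_above ((\<lambda>z. (1 - norm z ^ 2) powr \<beta> * norm (deriv (deriv f) z)) ` disc)}"

definition zyg_norm :: "real \<Rightarrow> (complex \<Rightarrow> complex) \<Rightarrow> real" where
  "zyg_norm \<beta> f = norm (f 0) + norm (deriv f 0) +
     (SUP z\<in>disc. (1 - norm z ^ 2) powr \<beta> * norm (deriv (deriv f) z))"

definition nu_norm :: "real \<Rightarrow> (complex \<Rightarrow> complex) \<Rightarrow> ereal" where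
  "nu_norm \<beta> g = (SUP z\<in>disc. ereal ((1 - norm z ^ 2) powr \<beta> * norm (g z)))"

definition bounded_BZ :: "real \<Rightarrow> ((complex \<Rightarrow> complex) \<Rightarrow> (complex \<Rightarrow> complex)) \<Rightarrow> bool" where
  "bounded_BZ \<beta> T \<longleftrightarrow> (\<forall>f\<in>bloch. T f \<in> zyg \<beta>) \<and>
     (\<exists>M. \<forall>f\<in>bloch. zyg_norm \<beta> (T f) \<le> M * bloch_norm f)"

definition linear_BZ :: "((complex \<Rightarrow> complex) \<Rightarrow> (complex \<Rightarrow> complex)) \<Rightarrow> bool" where
  "linear_BZ K \<longleftrightarrow> (\<forall>f\<in>bloch. \<forall>g\<in>bloch. \<forall>a b. \<forall>z\<in>disc.
     K (\<lambda>w. a * f w + b * g w) z = a * K f z + b * K g z)"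

definition compact_BZ :: "real \<Rightarrow> ((complex \<Rightarrow> complex) \<Rightarrow> (complex \<Rightarrow> complex)) \<Rightarrow> bool" where
  "compact_BZ \<beta> K \<longleftrightarrow> linear_BZ K \<and> (\<forall>f\<in>bloch. K f \<in> zyg \<beta>) \<and>
     (\<forall>s::nat \<Rightarrow> complex \<Rightarrow> complex. (\<forall>n. s n \<in> bloch \<and> bloch_norm (s n) \<le> 1) \<longrightarrow>
        (\<exists>r g. strict_mono r \<and> g \<in> zyg \<beta> \<and>
           (\<lambda>n. zyg_norm \<beta> (\<lambda>z. K (s (r n)) z - g z)) \<longlonglongrightarrow> 0))"

definition opnorm_BZ :: "real \<Rightarrow> ((complex \<Rightarrow> complex) \<Rightarrow> (complex \<Rightarrow> complex)) \<Rightarrow> real" where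
  "opnorm_BZ \<beta> T = (SUP f\<in>{f\<in>bloch. bloch_norm f \<le> 1}. zyg_norm \<beta> (T f))"

definition essnorm_BZ :: "real \<Rightarrow> ((complex \<Rightarrow> complex) \<Rightarrow> (complex \<Rightarrow> complex)) \<Rightarrow> real" where
  "essnorm_BZ \<beta> T = (INF K\<in>{K. compact_BZ \<beta> K}. opnorm_BZ \<beta> (\<lambda>f z. T f z - K f z))"

end

(* Writing T for the weighted composition operator, (T f)'' = u'' f(\<phi>) + (2 u' \<phi>' + u \<phi>'') f'(\<phi>) + u \<phi>'^2 f''(\<phi>),
   and a Bloch function in the unit ball has |f(w)|, |f'(w)|, |f''(w)| bounded by constant multiples of
   log(e/(1-|w|)), 1/(1-|w|), 1/(1-|w|)^2.  Taking n comparable to 1/(1-|\<phi>(z)|) turns the three power limsups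
   into weighted bounds on the three coefficients near |\<phi>(z)| = 1.

   Upper bound: T is approximated by the compact operators f |-> T(f(\<rho> .)) with \<rho> -> 1; the difference is small
   where |\<phi>(z)| stays away from 1 and is controlled by the coefficient bounds elsewhere.

   Lower bound: test functions concentrating at a = \<phi>(z), built from (1-|a|^2)/(1 - cnj a w) and
   (log(e/(1 - cnj a w)))^2, isolate the three coefficients in turn.  A compact K maps such a sequence to a norm-null
   one along a subsequence.  This is a gliding hump argument, which replaces weak convergence: if K f_n -> g with
   g nonzero, sums of N sparsely chosen f_n stay bounded in the Bloch norm while their images are close to N g. *)
theory Submission
  imports Defs "HOL-Complex_Analysis.Complex_Analysis"
begin

section \<open>Bloch and Zygmund-type norms\<close>

text \<open>The lower bound is an elimination in a triangular system. With k the kernel normalised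
  by k(a) = 1, the function k(1-k)^2 vanishes at a together with its derivative and shows only the
  coefficient of f''; k(1-k) vanishes at a and adds the coefficient of f'; the logarithmic function
  then yields u'' after subtraction of what is known. A single logarithm would not tend to 0 on
  compact sets; squaring it and dividing by its size at a keeps its value at a and creates this
  decay. The gliding hump needs more than Bloch bounds: each test function has a bounded derivative,
  so a finite sum contributes little to the weighted derivative near the circle, and the next
  summand can be taken small everywhere else. Bloch, Zygmund and operator norms are real suprema,
  informative only over bounded sets, so boundedness is proved before they are used. The infimum
  defining the essential norm need not be attained, whence \<open>ess + e\<close> with e > 0
  throughout. If |\<phi>| stays away from 1, the estimates near |\<phi>(z)| = 1 are vacuous and no
  separate case arises.\<close>

abbreviation wt :: "real \<Rightarrow> complex \<Rightarrow> real" where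
  "wt \<beta> z \<equiv> (1 - norm z ^ 2) powr \<beta>"

text \<open>Identities between functions are available only on the disc. As the disc is open, they
  hold near each of its points and so pass to derivatives there.\<close>

lemma disc_cong_deriv:
  assumes "\<And>w. w \<in> disc \<Longrightarrow> f w = g w" "z \<in> disc"
  shows "deriv f z = deriv g z"
  using assms by (intro deriv_cong_ev eventually_nhds_in_open[of disc, THEN eventually_mono]) auto

lemma has_deriv_disc:
  assumes "f holomorphic_on disc" "z \<in> disc"
  shows "(f has_field_derivative deriv f z) (at z)"
  using assms holomorphic_derivI open_ball by blast

lemma deriv_holomorphic_disc [simp, intro]:
  "f holomorphic_on disc \<Longrightarrow> deriv f holomorphic_on disc"
  by (simp add: holomorphic_deriv)

lemma deriv_lin:
  assumes "f holomorphic_on disc" "g holomorphic_on disc" "z \<in> disc"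
  shows "deriv (\<lambda>w. a * f w + b * g w) z = a * deriv f z + b * deriv g z"
  by (rule DERIV_imp_deriv) (auto intro!: derivative_eq_intros has_deriv_disc assms)

lemma deriv2_lin:
  assumes "f holomorphic_on disc" "g holomorphic_on disc" "z \<in> disc"
  shows "deriv (deriv (\<lambda>w. a * f w + b * g w)) z = a * deriv (deriv f) z + b * deriv (deriv g) z"
proof -
  have "deriv (deriv (\<lambda>w. a * f w + b * g w)) z = deriv (\<lambda>w. a * deriv f w + b * deriv g w) z"
    by (rule disc_cong_deriv) (use assms deriv_lin in auto)
  also have "\<dots> = a * deriv (deriv f) z + b * deriv (deriv g) z"
    by (rule deriv_lin) (use assms in auto)
  finally show ?thesis .
qed

lemma zyg_holo: "f \<in> zyg \<beta> \<Longrightarrow> f holomorphic_on disc"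
  by (simp add: zyg_def)

lemma zyg_norm_ge:
  assumes "f \<in> zyg \<beta>" "z \<in> disc"
  shows "norm (f 0) + norm (deriv f 0) + wt \<beta> z * norm (deriv (deriv f) z) \<le> zyg_norm \<beta> f"
  using assms unfolding zyg_def zyg_norm_def by (auto intro!: cSUP_upper)

lemma zyg_norm_nonneg: "f \<in> zyg \<beta> \<Longrightarrow> 0 \<le> zyg_norm \<beta> f"
  using zyg_norm_ge[of f \<beta> 0] by (smt (verit) centre_in_ball mult_nonneg_nonneg norm_ge_zero powr_ge_zero)

lemma zyg_point_le:
  assumes "f \<in> zyg \<beta>" "z \<in> disc"
  shows "wt \<beta> z * norm (deriv (deriv f) z) \<le> zyg_norm \<beta> f"
  using zyg_norm_ge[OF assms] norm_ge_zero[of "f 0"] norm_ge_zero[of "deriv f 0"] by linarith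

lemma zygI:
  assumes "f holomorphic_on disc" "\<And>z. z \<in> disc \<Longrightarrow> wt \<beta> z * norm (deriv (deriv f) z) \<le> B"
  shows "f \<in> zyg \<beta>" "zyg_norm \<beta> f \<le> norm (f 0) + norm (deriv f 0) + B"
proof -
  show "f \<in> zyg \<beta>"
    using assms unfolding zyg_def by (auto intro!: bdd_aboveI2)
  show "zyg_norm \<beta> f \<le> norm (f 0) + norm (deriv f 0) + B"
    unfolding zyg_norm_def using assms by (auto intro!: cSUP_least)
qed

lemma zyg_norm_cong:
  assumes "\<And>z. z \<in> disc \<Longrightarrow> f z = g z"
  shows "zyg_norm \<beta> f = zyg_norm \<beta> g"
proof -
  have 1: "deriv f z = deriv g z" if "z \<in> disc" for z
    using assms that by (rule disc_cong_deriv)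
  then have "deriv (deriv f) z = deriv (deriv g) z" if "z \<in> disc" for z
    using that by (rule disc_cong_deriv)
  then show ?thesis
    unfolding zyg_norm_def using 1 assms by simp
qed

lemma zyg_lin:
  assumes "f \<in> zyg \<beta>" "g \<in> zyg \<beta>"
  shows "(\<lambda>w. a * f w + b * g w) \<in> zyg \<beta>"
    "zyg_norm \<beta> (\<lambda>w. a * f w + b * g w) \<le> norm a * zyg_norm \<beta> f + norm b * zyg_norm \<beta> g"
proof -
  note h = zyg_holo[OF assms(1)] zyg_holo[OF assms(2)]
  let ?n0 = "\<lambda>f. norm (f 0) + norm (deriv f 0)"
  have hol: "(\<lambda>w. a * f w + b * g w) holomorphic_on disc"
    by (intro holomorphic_intros h)
  \<comment> \<open>The norm minus the two values at 0 is the second-derivative seminorm. In this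
    form \<open>zyg_norm_ge\<close> bounds it pointwise, and \<open>zygI\<close> adds the values at
    0 back.\<close>
  have pt: "wt \<beta> z * norm (deriv (deriv (\<lambda>w. a * f w + b * g w)) z)
    \<le> norm a * (zyg_norm \<beta> f - ?n0 f) + norm b * (zyg_norm \<beta> g - ?n0 g)" if "z \<in> disc" for z
  proof -
    have "wt \<beta> z * norm (deriv (deriv (\<lambda>w. a * f w + b * g w)) z)
      \<le> wt \<beta> z * (norm a * norm (deriv (deriv f) z) + norm b * norm (deriv (deriv g) z))"
      unfolding deriv2_lin[OF h that]
      by (intro mult_left_mono) (auto intro: norm_triangle_le simp: norm_mult)
    also have "\<dots> = norm a * (wt \<beta> z * norm (deriv (deriv f) z)) + norm b * (wt \<beta> z * norm (deriv (deriv g) z))"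
      by (simp add: algebra_simps)
    also have "\<dots> \<le> norm a * (zyg_norm \<beta> f - ?n0 f) + norm b * (zyg_norm \<beta> g - ?n0 g)"
      using zyg_norm_ge[OF assms(1) that] zyg_norm_ge[OF assms(2) that]
      by (intro add_mono mult_left_mono) auto
    finally show ?thesis .
  qed
  show "(\<lambda>w. a * f w + b * g w) \<in> zyg \<beta>"
    using zygI(1)[OF hol pt] .
  have "norm (a * f 0 + b * g 0) \<le> norm a * norm (f 0) + norm b * norm (g 0)"
    by (metis norm_mult norm_triangle_ineq)
  moreover have "norm (deriv (\<lambda>w. a * f w + b * g w) 0) \<le> norm a * norm (deriv f 0) + norm b * norm (deriv g 0)"
    using deriv_lin[OF h, of 0 a b] by (simp add: norm_triangle_le norm_mult)
  ultimately show "zyg_norm \<beta> (\<lambda>w. a * f w + b * g w) \<le> norm a * zyg_norm \<beta> f + norm b * zyg_norm \<beta> g"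
    using zygI(2)[OF hol pt] by (simp add: algebra_simps)
qed

lemma zyg_add:
  assumes "f \<in> zyg \<beta>" "g \<in> zyg \<beta>"
  shows "zyg_norm \<beta> (\<lambda>w. f w + g w) \<le> zyg_norm \<beta> f + zyg_norm \<beta> g"
  using zyg_lin(2)[OF assms, of 1 1] by simp

lemma zyg_diff:
  assumes "f \<in> zyg \<beta>" "g \<in> zyg \<beta>"
  shows "(\<lambda>w. f w - g w) \<in> zyg \<beta>" "zyg_norm \<beta> (\<lambda>w. f w - g w) \<le> zyg_norm \<beta> f + zyg_norm \<beta> g"
  using zyg_lin[OF assms, of 1 "-1"] by simp_all

lemma bloch_point_le:
  assumes "f \<in> bloch" "z \<in> disc"
  shows "norm (f 0) + (1 - norm z ^ 2) * norm (deriv f z) \<le> bloch_norm f"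
  using assms unfolding bloch_def bloch_norm_def by (auto intro!: cSUP_upper)

lemma blochI:
  assumes "f holomorphic_on disc" "\<And>z. z \<in> disc \<Longrightarrow> (1 - norm z ^ 2) * norm (deriv f z) \<le> B"
  shows "f \<in> bloch" "bloch_norm f \<le> norm (f 0) + B"
proof -
  show "f \<in> bloch"
    using assms unfolding bloch_def by (auto intro!: bdd_aboveI2)
  show "bloch_norm f \<le> norm (f 0) + B"
    unfolding bloch_norm_def using assms by (auto intro!: cSUP_least)
qed

lemma zero_in_bloch: "(\<lambda>z. 0) \<in> bloch" "bloch_norm (\<lambda>z. 0) \<le> 1"
  using blochI[of "\<lambda>z. 0" 0] by simp_all

text \<open>A sequence with images of norm above n has no subsequence with norm-convergent images.
  Boundedness is not written into \<open>compact_BZ\<close>, but the real supremum in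
  \<open>opnorm_BZ\<close> needs it.\<close>

lemma compact_BZ_bounded:
  assumes "compact_BZ \<beta> K"
  obtains B where "\<And>f. f \<in> bloch \<Longrightarrow> bloch_norm f \<le> 1 \<Longrightarrow> zyg_norm \<beta> (K f) \<le> B"
proof -
  have "\<exists>B. \<forall>f\<in>bloch. bloch_norm f \<le> 1 \<longrightarrow> zyg_norm \<beta> (K f) \<le> B"
  proof (rule ccontr)
    assume "\<not> ?thesis"
    then have "\<forall>n. \<exists>f. f \<in> bloch \<and> bloch_norm f \<le> 1 \<and> zyg_norm \<beta> (K f) > real n"
      by (meson not_le)
    then obtain s where s: "\<And>n. s n \<in> bloch" "\<And>n. bloch_norm (s n) \<le> 1" "\<And>n. zyg_norm \<beta> (K (s n)) > real n"
      by metis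
    then obtain r g where r: "strict_mono r" and g: "g \<in> zyg \<beta>"
      and lim: "(\<lambda>n. zyg_norm \<beta> (\<lambda>z. K (s (r n)) z - g z)) \<longlonglongrightarrow> 0"
      using assms unfolding compact_BZ_def by meson
    have Kz: "K (s n) \<in> zyg \<beta>" for n
      using assms s unfolding compact_BZ_def by blast
    have "\<forall>\<^sub>F n in sequentially. zyg_norm \<beta> (\<lambda>z. K (s (r n)) z - g z) < 1"
      using order_tendstoD(2)[OF lim] by simp
    moreover have "\<forall>\<^sub>F n in sequentially. n \<ge> nat \<lceil>1 + zyg_norm \<beta> g\<rceil>"
      by (rule eventually_ge_at_top)
    ultimately obtain n where n: "zyg_norm \<beta> (\<lambda>z. K (s (r n)) z - g z) < 1" "n \<ge> nat \<lceil>1 + zyg_norm \<beta> g\<rceil>"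
      using eventually_conj eventually_happens'[OF sequentially_bot] by blast
    have "zyg_norm \<beta> (K (s (r n))) \<le> zyg_norm \<beta> (\<lambda>z. K (s (r n)) z - g z) + zyg_norm \<beta> g"
      using zyg_add[OF zyg_diff(1)[OF Kz[of "r n"] g] g] by simp
    moreover have "real (r n) \<ge> real n"
      using seq_suble[OF r] by simp
    ultimately show False
      using s(3)[of "r n"] n by linarith
  qed
  then show thesis using that by blast
qed

section \<open>Compact operators and null sequences\<close>

text \<open>Each new summand is taken so late in the sequence that it is tiny on |z| \<le> s.
  Outside, the weight 1 - |z|^2 makes the earlier sum small, because \<open>little\<close> bounds
  its derivative. At no point do two summands have full size together, so the Bloch norm does not
  grow with N.\<close>

lemma compact_BZ_gliding_hump:
  assumes K: "compact_BZ \<beta> K" and g: "g \<in> zyg \<beta>"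
    and hol: "\<And>n. f n holomorphic_on disc"
    and bd: "\<And>n z. z \<in> disc \<Longrightarrow> (1 - norm z ^ 2) * norm (deriv (f n) z) \<le> 1 / 4"
    and little: "\<And>n. \<exists>B. \<forall>z\<in>disc. norm (deriv (f n) z) \<le> B"
    and null0: "(\<lambda>n. f n 0) \<longlonglongrightarrow> 0"
    and null1: "\<And>s e. s < 1 \<Longrightarrow> e > 0 \<Longrightarrow>
       \<forall>\<^sub>F n in sequentially. \<forall>z\<in>disc. norm z \<le> s \<longrightarrow> norm (deriv (f n) z) \<le> e"
    and near: "\<forall>\<^sub>F n in sequentially. zyg_norm \<beta> (\<lambda>z. K (f n) z - g z) \<le> \<delta>"
  shows "\<exists>S. S \<in> bloch \<and> bloch_norm S \<le> 1 \<and> zyg_norm \<beta> (\<lambda>z. K S z - of_nat N * g z) \<le> real N * \<delta>"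
proof -
  have lin: "K (\<lambda>w. a * p w + b * q w) z = a * K p z + b * K q z"
    if "p \<in> bloch" "q \<in> bloch" "z \<in> disc" for p q a b z
    using K that unfolding compact_BZ_def linear_BZ_def by blast
  have Kz: "K p \<in> zyg \<beta>" if "p \<in> bloch" for p
    using K that unfolding compact_BZ_def by blast
  \<comment> \<open>A geometric budget: passing from N to N + 1 spends e = c(N+1) - c(N), at 0 and
    in the weighted derivative on |z| \<le> s, and never more than 1/4 in total. At the end 1/4 at 0
    and 1/2 + 1/4 for the derivative add up to 1.\<close>
  define c where "c = (\<lambda>N::nat. 1 / 4 * (1 - (1 / 2) ^ N :: real))"
  have c_le: "c N \<le> 1 / 4" for N
    by (simp add: c_def)
  have c_ge: "0 \<le> c N" for N
    by (simp add: c_def power_le_one)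
  have "\<exists>S. S holomorphic_on disc \<and> (\<exists>B. \<forall>z\<in>disc. norm (deriv S z) \<le> B) \<and> norm (S 0) \<le> c N \<and>
    (\<forall>z\<in>disc. (1 - norm z ^ 2) * norm (deriv S z) \<le> 1 / 2 + c N) \<and>
    zyg_norm \<beta> (\<lambda>z. K S z - of_nat N * g z) \<le> real N * \<delta>"
  proof (induction N)
    case 0
    have "zyg_norm \<beta> (\<lambda>z. K (\<lambda>w. 0) z - of_nat 0 * g z) = zyg_norm \<beta> (\<lambda>z. 0)"
      using lin[OF zero_in_bloch(1) zero_in_bloch(1), of _ 0 0] by (intro zyg_norm_cong) simp
    also have "\<dots> \<le> 0"
      using zygI(2)[of "\<lambda>z. 0" \<beta> 0] by simp
    finally show ?case
      by (intro exI[of _ "\<lambda>w. 0"]) (auto simp: c_def)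
  next
    case (Suc N)
    then obtain S B where S: "S holomorphic_on disc" "\<And>z. z \<in> disc \<Longrightarrow> norm (deriv S z) \<le> B"
      "norm (S 0) \<le> c N" "\<And>z. z \<in> disc \<Longrightarrow> (1 - norm z ^ 2) * norm (deriv S z) \<le> 1 / 2 + c N"
      "zyg_norm \<beta> (\<lambda>z. K S z - of_nat N * g z) \<le> real N * \<delta>"
      by blast
    have B0: "B \<ge> 0"
      using order_trans[OF norm_ge_zero S(2)[of 0]] by simp
    \<comment> \<open>For |z| > s one has 1 - |z|^2 \<le> 1/(4(B+1)), so the old sum contributes at
      most 1/4 there. The new summand contributes at most 1/4 by \<open>bd\<close>; together this is
      the 1/2 in the invariant.\<close>
    define s where "s = 1 - 1 / (8 * (B + 1))"
    define e :: real where "e = 1 / 4 * (1 / 2) ^ Suc N"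
    have e: "e > 0" and s: "s < 1"
      using B0 by (simp_all add: e_def s_def)
    have ce: "c (Suc N) = c N + e"
      by (simp add: c_def e_def field_simps)
    have "\<forall>\<^sub>F n in sequentially. norm (f n 0) < e"
      using tendsto_norm_zero[OF null0] e by (rule order_tendstoD)
    from eventually_happens'[OF sequentially_bot eventually_conj[OF this eventually_conj[OF null1[OF s e] near]]]
    obtain k where k: "norm (f k 0) < e" "\<And>z. z \<in> disc \<Longrightarrow> norm z \<le> s \<Longrightarrow> norm (deriv (f k) z) \<le> e"
      "zyg_norm \<beta> (\<lambda>z. K (f k) z - g z) \<le> \<delta>"
      by blast
    obtain Bk where Bk: "\<And>z. z \<in> disc \<Longrightarrow> norm (deriv (f k) z) \<le> Bk"
      using little by blast
    define S' where "S' = (\<lambda>w. 1 * S w + 1 * f k w)"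
    have hol': "S' holomorphic_on disc"
      unfolding S'_def by (intro holomorphic_intros S hol)
    have dS': "deriv S' z = deriv S z + deriv (f k) z" if "z \<in> disc" for z
      unfolding S'_def using deriv_lin[OF S(1) hol that, of 1 1 k] by simp
    have "norm (deriv S' z) \<le> B + Bk" if "z \<in> disc" for z
      unfolding dS'[OF that] using S(2)[OF that] Bk[OF that] norm_triangle_ineq order_trans add_mono by metis
    moreover have "norm (S' 0) \<le> c (Suc N)"
      unfolding S'_def ce using S(3) k(1) norm_triangle_ineq[of "S 0" "f k 0"] by simp
    moreover have "(1 - norm z ^ 2) * norm (deriv S' z) \<le> 1 / 2 + c (Suc N)" if z: "z \<in> disc" for z
    proof -
      have q: "0 \<le> 1 - norm z ^ 2" "1 - norm z ^ 2 \<le> 1"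
        using z by (simp_all add: power_le_one)
      have "(1 - norm z ^ 2) * norm (deriv S' z)
        \<le> (1 - norm z ^ 2) * norm (deriv S z) + (1 - norm z ^ 2) * norm (deriv (f k) z)"
        unfolding dS'[OF z] distrib_left[symmetric] using q by (intro mult_left_mono norm_triangle_ineq)
      also have "\<dots> \<le> 1 / 2 + c (Suc N)"
      proof (cases "norm z \<le> s")
        case True
        have "(1 - norm z ^ 2) * norm (deriv (f k) z) \<le> 1 * e"
          using q k(2)[OF z True] by (intro mult_mono) auto
        then show ?thesis using S(4)[OF z] ce by simp
      next
        case False
        have "1 - norm z ^ 2 = (1 - norm z) * (1 + norm z)"
          by (simp add: power2_eq_square algebra_simps)
        also have "\<dots> \<le> (1 / (8 * (B + 1))) * 2"
          using z False B0 by (intro mult_mono) (auto simp: s_def)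
        finally have "(1 - norm z ^ 2) * norm (deriv S z) \<le> (1 / (8 * (B + 1))) * 2 * B"
          using S(2)[OF z] q B0 by (intro mult_mono) auto
        also have "\<dots> \<le> 1 / 4"
          using B0 by (simp add: field_simps)
        finally show ?thesis using bd[OF z, of k] c_ge[of "Suc N"] by linarith
      qed
      finally show ?thesis .
    qed
    moreover have "zyg_norm \<beta> (\<lambda>z. K S' z - of_nat (Suc N) * g z) \<le> real (Suc N) * \<delta>"
    proof -
      have Sb: "S \<in> bloch" and fb: "f k \<in> bloch"
        using S(1,4) hol bd blochI by blast+
      have "zyg_norm \<beta> (\<lambda>z. K S' z - of_nat (Suc N) * g z)
         = zyg_norm \<beta> (\<lambda>z. (K S z - of_nat N * g z) + (K (f k) z - g z))"
        using lin[OF Sb fb, of _ 1 1] unfolding S'_def by (intro zyg_norm_cong) (simp add: algebra_simps)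
      also have "\<dots> \<le> zyg_norm \<beta> (\<lambda>z. K S z - of_nat N * g z) + zyg_norm \<beta> (\<lambda>z. K (f k) z - g z)"
        using zyg_lin(1)[OF Kz[OF Sb] g, of 1 "- of_nat N"] zyg_diff(1)[OF Kz[OF fb] g]
        by (intro zyg_add) simp_all
      also have "\<dots> \<le> real (Suc N) * \<delta>"
        using S(5) k(3) by (simp add: algebra_simps)
      finally show ?thesis .
    qed
    ultimately show ?case using hol' by blast
  qed
  then obtain S where S: "S holomorphic_on disc" "norm (S 0) \<le> c N"
    "\<And>z. z \<in> disc \<Longrightarrow> (1 - norm z ^ 2) * norm (deriv S z) \<le> 1 / 2 + c N"
    "zyg_norm \<beta> (\<lambda>z. K S z - of_nat N * g z) \<le> real N * \<delta>"
    by blast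
  have "bloch_norm S \<le> 1"
    using blochI(2)[OF S(1,3)] S(2) c_le[of N] by simp
  then show ?thesis
    using blochI(1)[OF S(1,3)] S(4) by blast
qed

lemma compact_BZ_null_subsequence:
  assumes K: "compact_BZ \<beta> K"
    and hol: "\<And>n. f n holomorphic_on disc"
    and bd0: "\<And>n. norm (f n 0) \<le> 1 / 4"
    and bd: "\<And>n z. z \<in> disc \<Longrightarrow> (1 - norm z ^ 2) * norm (deriv (f n) z) \<le> 1 / 4"
    and little: "\<And>n. \<exists>B. \<forall>z\<in>disc. norm (deriv (f n) z) \<le> B"
    and null0: "(\<lambda>n. f n 0) \<longlonglongrightarrow> 0"
    and null1: "\<And>s e. s < 1 \<Longrightarrow> e > 0 \<Longrightarrow>
       \<forall>\<^sub>F n in sequentially. \<forall>z\<in>disc. norm z \<le> s \<longrightarrow> norm (deriv (f n) z) \<le> e"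
  obtains r where "strict_mono r" "(\<lambda>n. zyg_norm \<beta> (K (f (r n)))) \<longlonglongrightarrow> 0"
proof -
  have fb: "f n \<in> bloch" "bloch_norm (f n) \<le> 1" for n
    using blochI[OF hol bd, of n] bd0[of n] by simp_all
  then obtain r g where r: "strict_mono r" and g: "g \<in> zyg \<beta>"
    and lim: "(\<lambda>n. zyg_norm \<beta> (\<lambda>z. K (f (r n)) z - g z)) \<longlonglongrightarrow> 0"
    using K unfolding compact_BZ_def by meson
  have Kz: "K p \<in> zyg \<beta>" if "p \<in> bloch" for p
    using K that unfolding compact_BZ_def by blast
  obtain B where B: "\<And>p. p \<in> bloch \<Longrightarrow> bloch_norm p \<le> 1 \<Longrightarrow> zyg_norm \<beta> (K p) \<le> B"
    using compact_BZ_bounded[OF K] by blast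
  have "zyg_norm \<beta> g \<le> 0"
  proof (rule ccontr)
    assume "\<not> ?thesis"
    then have d: "zyg_norm \<beta> g / 2 > 0" by simp
    have near: "\<forall>\<^sub>F n in sequentially. zyg_norm \<beta> (\<lambda>z. K (f (r n)) z - g z) \<le> zyg_norm \<beta> g / 2"
      using order_tendstoD(2)[OF lim d] by (rule eventually_mono) simp
    have n0: "(\<lambda>n. f (r n) 0) \<longlonglongrightarrow> 0"
      using LIMSEQ_subseq_LIMSEQ[OF null0 r] by (simp add: o_def)
    have n1: "\<forall>\<^sub>F n in sequentially. \<forall>z\<in>disc. norm z \<le> s \<longrightarrow> norm (deriv (f (r n)) z) \<le> e"
      if "s < 1" "e > 0" for s e
      using eventually_compose_filterlim[OF null1[OF that] filterlim_subseq[OF r]] .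
    \<comment> \<open>The image of the sum S lies within N |g|/2 of N g, where |g| is the Zygmund
      norm, so it has norm at least N |g|/2. Since S is in the unit ball, this stays below B for
      every N, which is impossible for |g| > 0.\<close>
    have *: "real N * (zyg_norm \<beta> g / 2) \<le> B" for N
    proof -
      obtain S where S: "S \<in> bloch" "bloch_norm S \<le> 1"
        "zyg_norm \<beta> (\<lambda>z. K S z - of_nat N * g z) \<le> real N * (zyg_norm \<beta> g / 2)"
        using compact_BZ_gliding_hump[OF K g hol bd little n0 n1 near] by blast
      let ?A = "\<lambda>z. K S z - of_nat N * g z"
      have A: "?A \<in> zyg \<beta>"
        using zyg_lin(1)[OF Kz[OF S(1)] g, of 1 "- of_nat N"] by simp
      have "real N * zyg_norm \<beta> g \<le> zyg_norm \<beta> (K S) + zyg_norm \<beta> ?A"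
      proof (cases "N = 0")
        case True
        then show ?thesis
          using zyg_norm_nonneg[OF Kz[OF S(1)]] zyg_norm_nonneg[OF A] by simp
      next
        case False
        have "zyg_norm \<beta> g = zyg_norm \<beta> (\<lambda>z. (1 / of_nat N) * K S z + (- 1 / of_nat N) * ?A z)"
          using False by (intro zyg_norm_cong) (simp add: field_simps)
        also have "\<dots> \<le> norm (1 / of_nat N :: complex) * zyg_norm \<beta> (K S) + norm (- 1 / of_nat N :: complex) * zyg_norm \<beta> ?A"
          by (rule zyg_lin(2)[OF Kz[OF S(1)] A])
        finally show ?thesis using False by (simp add: norm_divide field_simps)
      qed
      then show ?thesis using S(3) B[OF S(1,2)] by simp
    qed
    obtain N where "real N * (zyg_norm \<beta> g / 2) > B"
      using reals_Archimedean3[OF d] by blast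
    with *[of N] show False by simp
  qed
  then have g0: "zyg_norm \<beta> g = 0"
    using zyg_norm_nonneg[OF g] by simp
  have "(\<lambda>n. zyg_norm \<beta> (K (f (r n)))) \<longlonglongrightarrow> 0"
  proof (rule tendsto_sandwich[OF _ _ tendsto_const lim])
    show "\<forall>\<^sub>F n in sequentially. 0 \<le> zyg_norm \<beta> (K (f (r n)))"
      using zyg_norm_nonneg[OF Kz[OF fb(1)]] by simp
    have "zyg_norm \<beta> (K (f (r n))) \<le> zyg_norm \<beta> (\<lambda>z. K (f (r n)) z - g z)" for n
      using zyg_add[OF zyg_diff(1)[OF Kz[OF fb(1)[of "r n"]] g] g] g0 by simp
    then show "\<forall>\<^sub>F n in sequentially. zyg_norm \<beta> (K (f (r n))) \<le> zyg_norm \<beta> (\<lambda>z. K (f (r n)) z - g z)"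
      by simp
  qed
  with r show thesis by (rule that)
qed

section \<open>Weighted composition operators\<close>

definition coeff1 :: "(complex \<Rightarrow> complex) \<Rightarrow> (complex \<Rightarrow> complex) \<Rightarrow> complex \<Rightarrow> complex" where
  "coeff1 u \<phi> z = 2 * deriv u z * deriv \<phi> z + u z * deriv (deriv \<phi>) z"

definition coeff2 :: "(complex \<Rightarrow> complex) \<Rightarrow> (complex \<Rightarrow> complex) \<Rightarrow> complex \<Rightarrow> complex" where
  "coeff2 u \<phi> z = u z * (deriv \<phi> z) ^ 2"

locale weighted_composition =
  fixes \<beta> :: real and u \<phi> :: "complex \<Rightarrow> complex"
  assumes u: "u holomorphic_on disc" and self: "self_map \<phi>" and bdd: "bounded_BZ \<beta> (wcomp u \<phi>)"
begin

lemma phi_holo: "\<phi> holomorphic_on disc"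
  using self by (simp add: self_map_def)

lemma phi_in [simp]: "z \<in> disc \<Longrightarrow> \<phi> z \<in> disc"
  using self unfolding self_map_def by blast

lemma phi_norm: "z \<in> disc \<Longrightarrow> norm (\<phi> z) < 1"
  using phi_in[of z] by simp

lemma comp_has_deriv:
  assumes "F holomorphic_on disc" "z \<in> disc"
  shows "((\<lambda>w. F (\<phi> w)) has_field_derivative deriv F (\<phi> z) * deriv \<phi> z) (at z)"
  using DERIV_chain2[OF has_deriv_disc[OF assms(1) phi_in[OF assms(2)]] has_deriv_disc[OF phi_holo assms(2)]] .

lemma wcomp_holo:
  assumes "F holomorphic_on disc"
  shows "wcomp u \<phi> F holomorphic_on disc"
proof -
  have "(F \<circ> \<phi>) holomorphic_on disc"
    using phi_holo assms self by (intro holomorphic_on_compose_gen[of _ _ _ disc]) (auto simp: self_map_def)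
  then show ?thesis
    unfolding wcomp_def by (intro holomorphic_intros u) (simp add: o_def)
qed

lemma wcomp_deriv:
  assumes "F holomorphic_on disc" "z \<in> disc"
  shows "deriv (wcomp u \<phi> F) z = deriv u z * F (\<phi> z) + u z * (deriv F (\<phi> z) * deriv \<phi> z)"
  unfolding wcomp_def
  by (rule DERIV_imp_deriv)
    (rule derivative_eq_intros comp_has_deriv has_deriv_disc u assms refl | simp)+

lemma wcomp_deriv2:
  assumes F: "F holomorphic_on disc" and z: "z \<in> disc"
  shows "deriv (deriv (wcomp u \<phi> F)) z =
    deriv (deriv u) z * F (\<phi> z) + coeff1 u \<phi> z * deriv F (\<phi> z) + coeff2 u \<phi> z * deriv (deriv F) (\<phi> z)"
proof -
  have "deriv (deriv (wcomp u \<phi> F)) z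
     = deriv (\<lambda>z. deriv u z * F (\<phi> z) + u z * (deriv F (\<phi> z) * deriv \<phi> z)) z"
    by (rule disc_cong_deriv[OF wcomp_deriv[OF F] z])
  also have "\<dots> = deriv (deriv u) z * F (\<phi> z) + deriv u z * (deriv F (\<phi> z) * deriv \<phi> z) +
    (deriv u z * (deriv F (\<phi> z) * deriv \<phi> z) +
     u z * ((deriv (deriv F) (\<phi> z) * deriv \<phi> z) * deriv \<phi> z + deriv F (\<phi> z) * deriv (deriv \<phi>) z))"
    apply (rule DERIV_imp_deriv)
    apply (rule derivative_eq_intros comp_has_deriv has_deriv_disc deriv_holomorphic_disc u F phi_holo z refl)+
    apply (simp add: algebra_simps)
    done
  also have "\<dots> = deriv (deriv u) z * F (\<phi> z) + coeff1 u \<phi> z * deriv F (\<phi> z) + coeff2 u \<phi> z * deriv (deriv F) (\<phi> z)"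
    by (simp add: coeff1_def coeff2_def algebra_simps power2_eq_square)
  finally show ?thesis .
qed

lemma wcomp_deriv2_bound:
  assumes F: "F holomorphic_on disc" and z: "z \<in> disc"
    and "norm (F (\<phi> z)) \<le> a" "norm (deriv F (\<phi> z)) \<le> b" "norm (deriv (deriv F) (\<phi> z)) \<le> c"
  shows "wt \<beta> z * norm (deriv (deriv (wcomp u \<phi> F)) z) \<le>
    wt \<beta> z * norm (deriv (deriv u) z) * a + wt \<beta> z * norm (coeff1 u \<phi> z) * b + wt \<beta> z * norm (coeff2 u \<phi> z) * c"
proof -
  have "norm (deriv (deriv (wcomp u \<phi> F)) z) \<le>
    norm (deriv (deriv u) z) * a + norm (coeff1 u \<phi> z) * b + norm (coeff2 u \<phi> z) * c"
    unfolding wcomp_deriv2[OF F z] using assms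
    by (intro norm_triangle_le add_mono) (auto simp: norm_mult intro!: mult_left_mono)
  then have "wt \<beta> z * norm (deriv (deriv (wcomp u \<phi> F)) z) \<le>
    wt \<beta> z * (norm (deriv (deriv u) z) * a + norm (coeff1 u \<phi> z) * b + norm (coeff2 u \<phi> z) * c)"
    by (intro mult_left_mono) auto
  then show ?thesis by (simp add: algebra_simps)
qed

lemma wcomp_zyg: "f \<in> bloch \<Longrightarrow> wcomp u \<phi> f \<in> zyg \<beta>"
  using bdd by (simp add: bounded_BZ_def)

lemma wcomp_power_bounded:
  "\<exists>B. \<forall>z\<in>disc. wt \<beta> z * norm (deriv (deriv (wcomp u \<phi> (\<lambda>w. w ^ k))) z) \<le> B"
proof -
  have d: "deriv (\<lambda>w::complex. w ^ k) z = of_nat k * z ^ (k - 1)" for z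
    by (rule DERIV_imp_deriv) (auto intro!: derivative_eq_intros)
  have "(1 - norm z ^ 2) * norm (deriv (\<lambda>w. w ^ k) z) \<le> 1 * (real k * 1)" if "z \<in> disc" for z
    unfolding d norm_mult norm_power using that
    by (intro mult_mono) (auto simp: power_le_one)
  then have "(\<lambda>w. w ^ k) \<in> bloch"
    by (intro blochI(1)[of _ "1 * (real k * 1)"]) (auto intro!: holomorphic_intros)
  from zyg_point_le[OF wcomp_zyg[OF this]] show ?thesis by blast
qed

text \<open>The images of 1, w and w^2 give a triangular system for the three coefficients, and
  |\<phi>| < 1 bounds the factors that arise in solving it.\<close>

lemma coeffs_bounded:
  obtains B where "0 \<le> B" "\<And>z. z \<in> disc \<Longrightarrow> wt \<beta> z * norm (deriv (deriv u) z) \<le> B"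
    "\<And>z. z \<in> disc \<Longrightarrow> wt \<beta> z * norm (coeff1 u \<phi> z) \<le> B"
    "\<And>z. z \<in> disc \<Longrightarrow> wt \<beta> z * norm (coeff2 u \<phi> z) \<le> B"
proof -
  obtain B0 where B0: "\<And>z. z \<in> disc \<Longrightarrow> wt \<beta> z * norm (deriv (deriv (wcomp u \<phi> (\<lambda>w. w ^ 0))) z) \<le> B0"
    using wcomp_power_bounded[of 0] by blast
  obtain B1 where B1: "\<And>z. z \<in> disc \<Longrightarrow> wt \<beta> z * norm (deriv (deriv (wcomp u \<phi> (\<lambda>w. w ^ 1))) z) \<le> B1"
    using wcomp_power_bounded[of 1] by blast
  obtain B2 where B2: "\<And>z. z \<in> disc \<Longrightarrow> wt \<beta> z * norm (deriv (deriv (wcomp u \<phi> (\<lambda>w. w ^ 2))) z) \<le> B2"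
    using wcomp_power_bounded[of 2] by blast
  have d2: "deriv (\<lambda>w::complex. w ^ 2) = (\<lambda>z. 2 * z)"
    by (intro ext DERIV_imp_deriv) (auto intro!: derivative_eq_intros)
  have b0: "wt \<beta> z * norm (deriv (deriv u) z) \<le> B0" if "z \<in> disc" for z
    using B0[OF that] wcomp_deriv2[of "\<lambda>w. w ^ 0" z] that by (simp add: holomorphic_intros)
  have b1: "wt \<beta> z * norm (coeff1 u \<phi> z) \<le> B1 + B0" if z: "z \<in> disc" for z
  proof -
    have "coeff1 u \<phi> z = deriv (deriv (wcomp u \<phi> (\<lambda>w. w ^ 1))) z - deriv (deriv u) z * \<phi> z"
      using wcomp_deriv2[of "\<lambda>w. w ^ 1" z] z by (simp add: holomorphic_intros)
    then have "norm (coeff1 u \<phi> z) \<le> norm (deriv (deriv (wcomp u \<phi> (\<lambda>w. w ^ 1))) z) + norm (deriv (deriv u) z) * norm (\<phi> z)"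
      using norm_triangle_ineq4 by (metis norm_mult)
    also have "\<dots> \<le> norm (deriv (deriv (wcomp u \<phi> (\<lambda>w. w ^ 1))) z) + norm (deriv (deriv u) z)"
      using phi_norm[OF z] by (simp add: mult_left_le)
    finally have "wt \<beta> z * norm (coeff1 u \<phi> z) \<le>
      wt \<beta> z * (norm (deriv (deriv (wcomp u \<phi> (\<lambda>w. w ^ 1))) z) + norm (deriv (deriv u) z))"
      by (intro mult_left_mono) auto
    then show ?thesis using B1[OF z] b0[OF z] by (simp add: algebra_simps)
  qed
  have b2: "wt \<beta> z * norm (coeff2 u \<phi> z) \<le> B2 + B0 + 2 * (B1 + B0)" if z: "z \<in> disc" for z
  proof -
    let ?D = "deriv (deriv (wcomp u \<phi> (\<lambda>w. w ^ 2))) z"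
    have "2 * coeff2 u \<phi> z = ?D - deriv (deriv u) z * \<phi> z ^ 2 - coeff1 u \<phi> z * (2 * \<phi> z)"
      using wcomp_deriv2[of "\<lambda>w. w ^ 2" z] z by (simp add: holomorphic_intros d2 algebra_simps)
    then have "2 * norm (coeff2 u \<phi> z) = norm (?D - deriv (deriv u) z * \<phi> z ^ 2 - coeff1 u \<phi> z * (2 * \<phi> z))"
      by (metis norm_mult norm_numeral)
    also have "\<dots> \<le> norm ?D + norm (deriv (deriv u) z) * norm (\<phi> z) ^ 2 + norm (coeff1 u \<phi> z) * (2 * norm (\<phi> z))"
      by (intro norm_triangle_le_diff add_mono) (auto simp: norm_mult norm_power)
    also have "\<dots> \<le> norm ?D + norm (deriv (deriv u) z) * 1 + norm (coeff1 u \<phi> z) * (2 * 1)"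
      using phi_norm[OF z] by (intro add_mono mult_left_mono) (auto simp: power_le_one)
    finally have "2 * norm (coeff2 u \<phi> z) \<le> norm ?D + norm (deriv (deriv u) z) + 2 * norm (coeff1 u \<phi> z)"
      by simp
    then have "norm (coeff2 u \<phi> z) \<le> norm ?D + norm (deriv (deriv u) z) + 2 * norm (coeff1 u \<phi> z)"
      using norm_ge_zero[of "coeff2 u \<phi> z"] by linarith
    then have "wt \<beta> z * norm (coeff2 u \<phi> z) \<le> wt \<beta> z * (norm ?D + norm (deriv (deriv u) z) + 2 * norm (coeff1 u \<phi> z))"
      by (intro mult_left_mono) auto
    then show ?thesis using B2[OF z] b0[OF z] b1[OF z] by (simp add: algebra_simps)
  qed
  show thesis
  proof (rule that[of "\<bar>B0\<bar> + \<bar>B1 + B0\<bar> + \<bar>B2 + B0 + 2 * (B1 + B0)\<bar>"])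
  qed (use b0 b1 b2 in \<open>fastforce intro: order_trans\<close>)+
qed

section \<open>Operator norms and the essential norm\<close>

lemma wcomp_minus_compact_bdd:
  assumes "compact_BZ \<beta> K"
  shows "bdd_above ((\<lambda>f. zyg_norm \<beta> (\<lambda>z. wcomp u \<phi> f z - K f z)) ` {f \<in> bloch. bloch_norm f \<le> 1})"
proof -
  obtain B where B: "\<And>f. f \<in> bloch \<Longrightarrow> bloch_norm f \<le> 1 \<Longrightarrow> zyg_norm \<beta> (K f) \<le> B"
    using compact_BZ_bounded[OF assms] by blast
  obtain M where M: "\<And>f. f \<in> bloch \<Longrightarrow> zyg_norm \<beta> (wcomp u \<phi> f) \<le> M * bloch_norm f"
    using bdd unfolding bounded_BZ_def by blast
  show ?thesis
  proof (rule bdd_aboveI2)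
    fix f assume "f \<in> {f \<in> bloch. bloch_norm f \<le> 1}"
    then have f: "f \<in> bloch" "bloch_norm f \<le> 1" by auto
    have "0 \<le> bloch_norm f"
      using bloch_point_le[OF f(1), of 0] by (auto intro: order_trans[rotated])
    then have "M * bloch_norm f \<le> \<bar>M\<bar> * 1"
      using f(2) by (intro mult_mono) auto
    moreover have "K f \<in> zyg \<beta>"
      using assms f(1) by (simp add: compact_BZ_def)
    ultimately show "zyg_norm \<beta> (\<lambda>z. wcomp u \<phi> f z - K f z) \<le> \<bar>M\<bar> + B"
      using zyg_diff(2)[OF wcomp_zyg[OF f(1)] \<open>K f \<in> zyg \<beta>\<close>] M[OF f(1)] B[OF f] by linarith
  qed
qed

text \<open>Members of a real supremum lie below it only when the set is bounded above;
  \<open>wcomp_minus_compact_bdd\<close> supplies this for the difference with a compact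
  operator.\<close>

lemma opnorm_ge:
  assumes "compact_BZ \<beta> K" "f \<in> bloch" "bloch_norm f \<le> 1"
  shows "zyg_norm \<beta> (\<lambda>z. wcomp u \<phi> f z - K f z) \<le> opnorm_BZ \<beta> (\<lambda>f z. wcomp u \<phi> f z - K f z)"
  unfolding opnorm_BZ_def
  by (rule cSUP_upper[OF _ wcomp_minus_compact_bdd[OF assms(1)]]) (use assms in auto)

lemma opnorm_nonneg:
  assumes "compact_BZ \<beta> K"
  shows "0 \<le> opnorm_BZ \<beta> (\<lambda>f z. wcomp u \<phi> f z - K f z)"
proof -
  have "K (\<lambda>z. 0) \<in> zyg \<beta>"
    using assms zero_in_bloch by (simp add: compact_BZ_def)
  from zyg_norm_nonneg[OF zyg_diff(1)[OF wcomp_zyg[OF zero_in_bloch(1)] this]]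
  show ?thesis using opnorm_ge[OF assms zero_in_bloch] by linarith
qed

abbreviation ess :: real where "ess \<equiv> essnorm_BZ \<beta> (wcomp u \<phi>)"

text \<open>Keeps the set of competitors in the infimum of \<open>essnorm_BZ\<close> nonempty,
  without which that infimum could not be bounded below or approximated.\<close>

lemma zero_compact: "compact_BZ \<beta> (\<lambda>f z. 0)"
proof -
  have "(\<lambda>z. 0) \<in> zyg \<beta>"
    by (rule zygI(1)[of _ _ 0]) auto
  moreover have "zyg_norm \<beta> (\<lambda>z. 0) = 0"
    by (simp add: zyg_norm_def)
  ultimately show ?thesis
    unfolding compact_BZ_def linear_BZ_def
    by (auto intro!: exI[of _ "\<lambda>n::nat. n"] exI[of _ "\<lambda>z::complex. 0::complex"] simp: strict_mono_def)
qed

lemma ess_le: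
  assumes "compact_BZ \<beta> K"
  shows "ess \<le> opnorm_BZ \<beta> (\<lambda>f z. wcomp u \<phi> f z - K f z)"
  unfolding essnorm_BZ_def
  by (rule cINF_lower) (use assms opnorm_nonneg in \<open>auto intro!: bdd_belowI2\<close>)

lemma ess_nonneg: "0 \<le> ess"
  unfolding essnorm_BZ_def
  by (rule cINF_greatest) (use zero_compact opnorm_nonneg in auto)

lemma ess_approx:
  assumes "e > 0"
  obtains K where "compact_BZ \<beta> K" "opnorm_BZ \<beta> (\<lambda>f z. wcomp u \<phi> f z - K f z) < ess + e"
proof -
  have "\<exists>x\<in>(\<lambda>K. opnorm_BZ \<beta> (\<lambda>f z. wcomp u \<phi> f z - K f z)) ` {K. compact_BZ \<beta> K}. x < ess + e"
    using assms zero_compact unfolding essnorm_BZ_def by (intro cInf_lessD) auto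
  then show thesis using that by blast
qed

text \<open>If the bound failed at points with |\<phi>(z)| tending to 1, the functions f(\<phi>(z))
  attached to them, scaled by 1/(4C), would satisfy the hypotheses of
  \<open>compact_BZ_null_subsequence\<close>. A nearly optimal K makes the image of one of them
  small, so its image under the composition operator has norm below \<open>ess + e\<close>;
  evaluating the second derivative at the attached point contradicts the failure. The factor 4C
  undoes the scaling.\<close>

lemma ess_test_family:
  assumes hol: "\<And>a. a \<in> disc \<Longrightarrow> f a holomorphic_on disc"
    and C: "C > 0"
    and bd0: "\<And>a. a \<in> disc \<Longrightarrow> norm (f a 0) \<le> C"
    and bd: "\<And>a z. a \<in> disc \<Longrightarrow> z \<in> disc \<Longrightarrow> (1 - norm z ^ 2) * norm (deriv (f a) z) \<le> C"
    and little: "\<And>a. a \<in> disc \<Longrightarrow> \<exists>B. \<forall>z\<in>disc. norm (deriv (f a) z) \<le> B"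
    and null: "\<And>s e. s < 1 \<Longrightarrow> e > 0 \<Longrightarrow> \<exists>t<1. \<forall>a\<in>disc. t < norm a \<longrightarrow>
       norm (f a 0) < e \<and> (\<forall>z\<in>disc. norm z \<le> s \<longrightarrow> norm (deriv (f a) z) \<le> e)"
    and e: "e > 0"
  shows "\<exists>s<1. \<forall>z\<in>disc. s < norm (\<phi> z) \<longrightarrow>
     wt \<beta> z * norm (deriv (deriv (wcomp u \<phi> (f (\<phi> z)))) z) \<le> 4 * C * (ess + e)"
proof (rule ccontr)
  assume neg: "\<not> ?thesis"
  have "\<exists>z\<in>disc. 1 - 1 / real (Suc n) < norm (\<phi> z) \<and>
     wt \<beta> z * norm (deriv (deriv (wcomp u \<phi> (f (\<phi> z)))) z) > 4 * C * (ess + e)" for n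
    using neg[unfolded not_ex, THEN spec, of "1 - 1 / real (Suc n)"] by (auto simp: not_le)
  then obtain \<zeta> where \<zeta>: "\<And>n. \<zeta> n \<in> disc" "\<And>n. 1 - 1 / real (Suc n) < norm (\<phi> (\<zeta> n))"
    "\<And>n. wt \<beta> (\<zeta> n) * norm (deriv (deriv (wcomp u \<phi> (f (\<phi> (\<zeta> n))))) (\<zeta> n)) > 4 * C * (ess + e)"
    by metis
  define a where "a = (\<lambda>n. \<phi> (\<zeta> n))"
  have a: "a n \<in> disc" for n
    unfolding a_def using phi_in[OF \<zeta>(1)] .
  have "1 / real (Suc n) \<ge> 1 - norm (a n)" for n
    using \<zeta>(2)[of n] by (simp add: a_def)
  have ev: "\<forall>\<^sub>F n in sequentially. t < norm (a n)" if "t < 1" for t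
  proof -
    have "(\<lambda>n. 1 - 1 / real (Suc n)) \<longlonglongrightarrow> 1 - 0"
      by (intro tendsto_intros LIMSEQ_Suc[OF lim_1_over_n])
    then have "\<forall>\<^sub>F n in sequentially. t < 1 - 1 / real (Suc n)"
      using that by (intro order_tendstoD(1)) auto
    then show ?thesis
      by (rule eventually_mono) (use \<zeta>(2) in \<open>auto simp: a_def intro: less_trans\<close>)
  qed
  \<comment> \<open>One half of e pays for K not being optimal, the other for the image under K of a
    late test function.\<close>
  obtain K where K: "compact_BZ \<beta> K" and Kn: "opnorm_BZ \<beta> (\<lambda>f z. wcomp u \<phi> f z - K f z) < ess + e / 2"
    using ess_approx[of "e / 2"] e by auto
  define c :: complex where "c = of_real (1 / (4 * C))"
  have nc: "norm c = 1 / (4 * C)"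
    using C by (simp add: c_def norm_divide norm_mult)
  define F where "F = (\<lambda>n w. c * f (a n) w)"
  have Fh: "F n holomorphic_on disc" for n
    unfolding F_def by (intro holomorphic_intros hol a)
  have dF: "deriv (F n) z = c * deriv (f (a n)) z" if "z \<in> disc" for n z
    using deriv_lin[OF hol[OF a] hol[OF a] that, of c n 0] by (simp add: F_def)
  have F0: "norm (F n 0) \<le> 1 / 4" for n
    using bd0[OF a, of n] C by (simp add: F_def norm_mult nc field_simps)
  have Fb: "(1 - norm z ^ 2) * norm (deriv (F n) z) \<le> 1 / 4" if "z \<in> disc" for n z
    using bd[OF a that, of n] C by (simp add: dF[OF that] norm_mult nc field_simps)
  have Fl: "\<exists>B. \<forall>z\<in>disc. norm (deriv (F n) z) \<le> B" for n
  proof -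
    obtain B where "\<And>z. z \<in> disc \<Longrightarrow> norm (deriv (f (a n)) z) \<le> B"
      using little[OF a] by blast
    then show ?thesis
      by (intro exI[of _ "norm c * B"]) (simp add: dF norm_mult mult_left_mono)
  qed
  have nulls: "\<forall>\<^sub>F n in sequentially. norm (F n 0) < d \<and> (\<forall>z\<in>disc. norm z \<le> s \<longrightarrow> norm (deriv (F n) z) \<le> d)"
    if "s < 1" "d > 0" for s d
  proof -
    have "d * (4 * C) > 0" using that C by simp
    from null[OF \<open>s < 1\<close> this] obtain t where t: "t < 1" "\<And>b. b \<in> disc \<Longrightarrow> t < norm b \<Longrightarrow>
       norm (f b 0) < d * (4 * C) \<and> (\<forall>z\<in>disc. norm z \<le> s \<longrightarrow> norm (deriv (f b) z) \<le> d * (4 * C))"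
      by blast
    from ev[OF t(1)] show ?thesis
    proof (rule eventually_mono)
      fix n assume "t < norm (a n)"
      from t(2)[OF a this] C have "norm (F n 0) < d" "\<forall>z\<in>disc. norm z \<le> s \<longrightarrow> norm (c * deriv (f (a n)) z) \<le> d"
        by (auto simp: norm_mult nc F_def divide_simps mult.commute)
      then show "norm (F n 0) < d \<and> (\<forall>z\<in>disc. norm z \<le> s \<longrightarrow> norm (deriv (F n) z) \<le> d)"
        using dF by metis
    qed
  qed
  have "\<forall>\<^sub>F n in sequentially. norm (F n 0) < d" if "d > 0" for d
    using nulls[OF _ that, of 0] by (rule eventually_mono) auto
  then have lim0: "(\<lambda>n. F n 0) \<longlonglongrightarrow> 0"
    by (simp add: tendsto_iff)
  have lim1: "\<forall>\<^sub>F n in sequentially. \<forall>z\<in>disc. norm z \<le> s \<longrightarrow> norm (deriv (F n) z) \<le> d"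
    if "s < 1" "d > 0" for s d
    using nulls[OF that] by (rule eventually_mono) blast
  obtain r where r: "strict_mono r" and lim: "(\<lambda>n. zyg_norm \<beta> (K (F (r n)))) \<longlonglongrightarrow> 0"
    using compact_BZ_null_subsequence[OF K Fh F0 Fb Fl lim0 lim1] by blast
  have "\<forall>\<^sub>F n in sequentially. zyg_norm \<beta> (K (F (r n))) < e / 2"
    using e by (intro order_tendstoD(2)[OF lim]) simp
  then obtain n where n: "zyg_norm \<beta> (K (F (r n))) < e / 2"
    using eventually_happens'[OF sequentially_bot] by blast
  define m where "m = r n"
  have Fbl: "F m \<in> bloch" "bloch_norm (F m) \<le> 1"
    using blochI[OF Fh Fb, of m] F0[of m] by simp_all
  have Kz: "K (F m) \<in> zyg \<beta>"
    using K Fbl(1) by (simp add: compact_BZ_def)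
  have "zyg_norm \<beta> (wcomp u \<phi> (F m)) \<le> zyg_norm \<beta> (\<lambda>z. wcomp u \<phi> (F m) z - K (F m) z) + zyg_norm \<beta> (K (F m))"
    using zyg_add[OF zyg_diff(1)[OF wcomp_zyg[OF Fbl(1)] Kz] Kz] by simp
  also have "\<dots> < ess + e"
    using opnorm_ge[OF K Fbl] Kn n by (simp add: m_def)
  finally have *: "wt \<beta> (\<zeta> m) * norm (deriv (deriv (wcomp u \<phi> (F m))) (\<zeta> m)) < ess + e"
    using zyg_point_le[OF wcomp_zyg[OF Fbl(1)] \<zeta>(1)] by (meson le_less_trans)
  \<comment> \<open>A scalar multiple is written as a combination with second coefficient 0, so that
    \<open>deriv2_lin\<close> applies.\<close>
  have "wcomp u \<phi> (F m) = (\<lambda>w. c * wcomp u \<phi> (f (a m)) w + 0 * wcomp u \<phi> (f (a m)) w)"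
    by (auto simp: wcomp_def F_def)
  then have "deriv (deriv (wcomp u \<phi> (F m))) (\<zeta> m) = c * deriv (deriv (wcomp u \<phi> (f (a m)))) (\<zeta> m)"
    using deriv2_lin[OF wcomp_holo[OF hol[OF a]] wcomp_holo[OF hol[OF a]] \<zeta>(1), of c m 0] by simp
  with * C have "wt \<beta> (\<zeta> m) * norm (deriv (deriv (wcomp u \<phi> (f (a m)))) (\<zeta> m)) < 4 * C * (ess + e)"
    by (simp add: norm_mult nc field_simps)
  then show False
    using \<zeta>(3)[of m] by (simp add: a_def)
qed

end

section \<open>Test functions\<close>

text \<open>All bounds come from |cnj a z| \<le> min(|a|, |z|) < 1. The positive real part keeps the
  denominator off the branch cut of \<open>Ln\<close>.\<close>

lemma mobius_denom:
  assumes "a \<in> disc" "z \<in> disc"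
  shows "1 - norm z \<le> norm (1 - cnj a * z)" "1 - norm a \<le> norm (1 - cnj a * z)"
    "norm (1 - cnj a * z) \<le> 2" "1 - cnj a * z \<noteq> 0" "0 < Re (1 - cnj a * z)"
proof -
  have "norm (cnj a * z) \<le> norm z" "norm (cnj a * z) \<le> norm a" "norm (cnj a * z) < 1"
    using assms mult_left_le_one_le[of "norm z" "norm a"] mult_left_le[of "norm z" "norm a"]
    by (auto simp: norm_mult)
  moreover have "1 - norm (cnj a * z) \<le> norm (1 - cnj a * z)" "norm (1 - cnj a * z) \<le> 1 + norm (cnj a * z)"
    using norm_triangle_ineq2[of 1 "cnj a * z"] norm_triangle_ineq4[of 1 "cnj a * z"] by simp_all
  moreover have "Re (cnj a * z) \<le> norm (cnj a * z)"
    by (rule complex_Re_le_cmod)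
  ultimately show "1 - norm z \<le> norm (1 - cnj a * z)" "1 - norm a \<le> norm (1 - cnj a * z)"
    "norm (1 - cnj a * z) \<le> 2" "1 - cnj a * z \<noteq> 0" "0 < Re (1 - cnj a * z)"
    by (linarith | force)+
qed

lemma one_minus_sq_le: "0 \<le> x \<Longrightarrow> x < 1 \<Longrightarrow> 1 - x ^ 2 \<le> 2 * (1 - x :: real)"
  using zero_le_power2[of "1 - x"] by (simp add: power2_eq_square algebra_simps)

lemma one_minus_sq_pos: "z \<in> disc \<Longrightarrow> 0 < 1 - norm z ^ 2"
  by (simp add: power_less_one_iff)

section \<open>Rational test functions\<close>

definition kern :: "complex \<Rightarrow> complex \<Rightarrow> complex" where
  "kern a z = of_real (1 - norm a ^ 2) / (1 - cnj a * z)"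

text \<open>The derivative is a multiple of the square of the kernel itself. Derivatives of
  polynomials in the kernel are therefore again such polynomials, and their values at a follow from
  \<open>kern_self\<close>.\<close>

lemma kern_deriv:
  assumes "a \<in> disc" "z \<in> disc"
  shows "(kern a has_field_derivative cnj a / of_real (1 - norm a ^ 2) * kern a z ^ 2) (at z)"
proof -
  let ?s = "of_real (1 - norm a ^ 2) :: complex"
  have s: "?s \<noteq> 0"
    using one_minus_sq_pos[OF assms(1)] by (metis less_irrefl of_real_eq_0_iff)
  show ?thesis
    unfolding kern_def[abs_def] using mobius_denom(4)[OF assms] s
    by (auto intro!: derivative_eq_intros simp: power2_eq_square divide_simps simp del: of_real_diff)
qed

lemma kern_self: "a \<in> disc \<Longrightarrow> kern a a = 1"
proof -
  assume a: "a \<in> disc"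
  have "1 - cnj a * a = of_real (1 - norm a ^ 2)"
    by (metis complex_norm_square mult.commute of_real_1 of_real_diff)
  then show ?thesis
    using mobius_denom(4)[OF a a] by (simp add: kern_def)
qed

text \<open>The constant bound serves the uniform Bloch estimate; the other one makes the kernel
  tend to 0 on |z| \<le> s as |a| tends to 1.\<close>

lemma kern_norm_le:
  assumes "a \<in> disc" "z \<in> disc"
  shows "norm (kern a z) \<le> 2" "norm (kern a z) \<le> (1 - norm a ^ 2) / (1 - norm z)"
proof -
  have n: "norm (kern a z) = (1 - norm a ^ 2) / norm (1 - cnj a * z)"
    using one_minus_sq_pos[OF assms(1)] unfolding kern_def norm_divide norm_of_real by simp
  have "(1 - norm a ^ 2) / norm (1 - cnj a * z) \<le> 2 * (1 - norm a) / (1 - norm a)"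
    using assms mobius_denom[OF assms] one_minus_sq_le[of "norm a"] by (intro frac_le) auto
  also have "\<dots> = 2"
    using assms(1) by (simp add: field_simps)
  finally show "norm (kern a z) \<le> 2"
    using n by simp
  show "norm (kern a z) \<le> (1 - norm a ^ 2) / (1 - norm z)"
    unfolding n using assms mobius_denom[OF assms] one_minus_sq_pos[OF assms(1)] by (intro frac_le) auto
qed

text \<open>The parameters prescribe zeros at a, where the kernel k equals 1: b = -2, c = 1 gives
  k(1-k)^2, and b = -1, c = 0 gives k(1-k).\<close>

definition kern_poly :: "complex \<Rightarrow> complex \<Rightarrow> complex \<Rightarrow> complex \<Rightarrow> complex" where
  "kern_poly b c a z = kern a z + b * kern a z ^ 2 + c * kern a z ^ 3"

lemma kern_poly_has_deriv:
  assumes "a \<in> disc" "z \<in> disc"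
  shows "(kern_poly b c a has_field_derivative
    cnj a / of_real (1 - norm a ^ 2) * kern a z ^ 2 * (1 + 2 * b * kern a z + 3 * c * kern a z ^ 2)) (at z)"
  unfolding kern_poly_def[abs_def]
  by (rule derivative_eq_intros kern_deriv assms refl)+ (simp add: algebra_simps power2_eq_square)

lemma kern_poly_holo: "a \<in> disc \<Longrightarrow> kern_poly b c a holomorphic_on disc"
  using kern_poly_has_deriv by (meson holomorphic_on_open open_ball)

lemma kern_poly_deriv:
  assumes "a \<in> disc" "z \<in> disc"
  shows "deriv (kern_poly b c a) z =
    cnj a / of_real (1 - norm a ^ 2) * kern a z ^ 2 * (1 + 2 * b * kern a z + 3 * c * kern a z ^ 2)"
  using DERIV_imp_deriv[OF kern_poly_has_deriv[OF assms]] .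

lemma kern_poly_deriv2:
  assumes "a \<in> disc"
  shows "deriv (deriv (kern_poly b c a)) a = (cnj a / of_real (1 - norm a ^ 2)) ^ 2 * (2 + 6 * b + 12 * c)"
proof -
  define k where "k = cnj a / of_real (1 - norm a ^ 2)"
  have k: "(kern a has_field_derivative k * kern a a ^ 2) (at a)"
    unfolding k_def by (rule kern_deriv[OF assms assms])
  have "deriv (deriv (kern_poly b c a)) a =
    deriv (\<lambda>z. k * kern a z ^ 2 * (1 + 2 * b * kern a z + 3 * c * kern a z ^ 2)) a"
    unfolding k_def by (rule disc_cong_deriv[OF kern_poly_deriv[OF assms] assms])
  \<comment> \<open>Two differentiations of the m-th power of the kernel produce m(m+1) at a, hence
    2, 6 and 12.\<close>
  also have "\<dots> = k ^ 2 * (2 + 6 * b + 12 * c)"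
    by (rule DERIV_imp_deriv, (rule derivative_eq_intros k refl)+)
      (simp add: kern_self[OF assms] algebra_simps power2_eq_square)
  finally show ?thesis
    unfolding k_def .
qed

text \<open>Only one of the two kernel factors in the derivative is spent on cancelling 1 - |a|^2.
  The other is kept: its bound 2 yields \<open>kern_poly_bloch\<close>, its decay yields
  \<open>kern_poly_null\<close>.\<close>

lemma kern_poly_deriv_le:
  assumes "a \<in> disc" "z \<in> disc"
  shows "norm (deriv (kern_poly b c a) z) \<le>
    norm (kern a z) / (1 - norm z) * (1 + 4 * norm b + 12 * norm c)"
proof -
  let ?s = "1 - norm a ^ 2"
  have s: "?s > 0" using one_minus_sq_pos[OF assms(1)] .
  note k = kern_norm_le[OF assms]
  have "norm (1 + 2 * b * kern a z + 3 * c * kern a z ^ 2) \<le>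
    1 + 2 * norm b * norm (kern a z) + 3 * norm c * norm (kern a z) ^ 2"
    by (intro norm_triangle_le add_mono) (auto simp: norm_mult norm_power)
  also have "\<dots> \<le> 1 + 2 * norm b * 2 + 3 * norm c * 2 ^ 2"
    using k by (intro add_mono mult_left_mono power_mono) auto
  finally have p: "norm (1 + 2 * b * kern a z + 3 * c * kern a z ^ 2) \<le> 1 + 4 * norm b + 12 * norm c"
    by simp
  have "norm (cnj a / of_real ?s * kern a z ^ 2) = norm a * (norm (kern a z) * (norm (kern a z) / ?s))"
    using s unfolding norm_mult norm_divide norm_power norm_of_real by (simp add: power2_eq_square)
  also have "\<dots> \<le> 1 * (norm (kern a z) * (1 / (1 - norm z)))"
    using assms k(2) s by (intro mult_mono) (auto simp: field_simps)
  finally show ?thesis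
    unfolding kern_poly_deriv[OF assms] norm_mult[of "_ * _ ^ 2"] using p assms by (intro mult_mono) auto
qed

lemma kern_poly_0_le:
  assumes "a \<in> disc"
  shows "norm (kern_poly b c a 0) \<le> (1 - norm a ^ 2) * (1 + 4 * norm b + 12 * norm c)"
proof -
  let ?s = "1 - norm a ^ 2"
  have s: "0 \<le> ?s" "?s \<le> 1" using one_minus_sq_pos[OF assms] by auto
  have p: "?s ^ 2 \<le> ?s" "?s ^ 3 \<le> ?s"
    using s power_decreasing[of 1 2 ?s] power_decreasing[of 1 3 ?s] by auto
  have n: "norm (kern a 0) = ?s"
    unfolding kern_def norm_divide norm_of_real using s by simp
  have "norm (kern_poly b c a 0) \<le> norm (kern a 0) + norm b * norm (kern a 0) ^ 2 + norm c * norm (kern a 0) ^ 3"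
    unfolding kern_poly_def by (intro norm_triangle_le add_mono) (auto simp: norm_mult norm_power)
  also have "\<dots> \<le> ?s + norm b * ?s + norm c * ?s"
    unfolding n using p by (intro add_mono mult_left_mono) auto
  also have "\<dots> = ?s * (1 + norm b + norm c)"
    by (simp add: algebra_simps)
  also have "\<dots> \<le> ?s * (1 + 4 * norm b + 12 * norm c)"
    using s by (intro mult_left_mono) auto
  finally show ?thesis .
qed

section \<open>Logarithmic test functions\<close>

definition lgw :: "complex \<Rightarrow> real" where
  "lgw a = 1 - ln (1 - norm a ^ 2)"

text \<open>With l = \<open>lgw a\<close> = log(e/(1-|a|^2)), the base 1 - Ln(1 - cnj a z) equals l
  at z = a. The quotient thus takes the value l at a, while on |z| \<le> s < 1 the numerator is
  bounded independently of a and division by l forces decay.\<close>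

definition log_test :: "complex \<Rightarrow> complex \<Rightarrow> complex" where
  "log_test a z = (1 - Ln (1 - cnj a * z)) ^ 2 / of_real (lgw a)"

lemma lgw_ge: "a \<in> disc \<Longrightarrow> 1 \<le> lgw a"
  using one_minus_sq_pos[of a] by (simp add: lgw_def)

lemma log_base_has_deriv:
  assumes "a \<in> disc" "z \<in> disc"
  shows "((\<lambda>z. 1 - Ln (1 - cnj a * z)) has_field_derivative cnj a / (1 - cnj a * z)) (at z)"
proof -
  have "1 - cnj a * z \<notin> \<real>\<^sub>\<le>\<^sub>0"
    using mobius_denom(5)[OF assms] by (auto simp: complex_nonpos_Reals_iff)
  then show ?thesis
    by (auto intro!: derivative_eq_intros simp: field_simps)
qed

lemma log_test_has_deriv:
  assumes "a \<in> disc" "z \<in> disc"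
  shows "(log_test a has_field_derivative
    2 * (1 - Ln (1 - cnj a * z)) * (cnj a / (1 - cnj a * z)) / of_real (lgw a)) (at z)"
proof -
  have "(of_real (lgw a) :: complex) \<noteq> 0"
    using lgw_ge[OF assms(1)] by simp
  then show ?thesis
    unfolding log_test_def[abs_def]
    by - (rule derivative_eq_intros log_base_has_deriv assms refl | simp)+
qed

lemma log_test_holo: "a \<in> disc \<Longrightarrow> log_test a holomorphic_on disc"
  using log_test_has_deriv by (meson holomorphic_on_open open_ball)

lemma log_test_deriv:
  assumes "a \<in> disc" "z \<in> disc"
  shows "deriv (log_test a) z = 2 * (1 - Ln (1 - cnj a * z)) * (cnj a / (1 - cnj a * z)) / of_real (lgw a)"
  using DERIV_imp_deriv[OF log_test_has_deriv[OF assms]] .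

lemma log_base_self:
  assumes "a \<in> disc"
  shows "1 - cnj a * a = of_real (1 - norm a ^ 2)" "1 - Ln (1 - cnj a * a) = of_real (lgw a)"
proof -
  show 1: "1 - cnj a * a = of_real (1 - norm a ^ 2)"
    by (metis complex_norm_square mult.commute of_real_1 of_real_diff)
  show "1 - Ln (1 - cnj a * a) = of_real (lgw a)"
    unfolding 1 lgw_def using one_minus_sq_pos[OF assms] by (subst Ln_of_real) auto
qed

lemma log_test_self:
  assumes "a \<in> disc"
  shows "log_test a a = of_real (lgw a)"
    "norm (deriv (log_test a) a) \<le> 2 / (1 - norm a ^ 2)"
    "norm (deriv (deriv (log_test a)) a) \<le> 4 / (1 - norm a ^ 2) ^ 2"
proof -
  let ?s = "1 - norm a ^ 2"
  let ?l = "of_real (lgw a) :: complex"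
  have s: "?s > 0" using one_minus_sq_pos[OF assms] .
  have a1: "norm a \<le> 1" using assms by simp
  have l: "?l \<noteq> 0" using lgw_ge[OF assms] by simp
  note ls = log_base_self[OF assms]
  show "log_test a a = ?l"
    using l by (simp add: log_test_def ls(2) power2_eq_square)
  have "norm (deriv (log_test a) a) = 2 * norm a / ?s"
    unfolding log_test_deriv[OF assms assms] ls(2) unfolding ls(1) using l s
    by (simp add: norm_divide norm_mult del: of_real_diff)
  also have "\<dots> \<le> 2 / ?s"
    using a1 s by (intro divide_right_mono) auto
  finally show "norm (deriv (log_test a) a) \<le> 2 / ?s" .
  \<comment> \<open>Here Q' = P and P' = P^2, so the derivative of 2QP/l, with l =
    \<open>lgw a\<close>, is 2P^2/l + 2QP^2/l. At a one has Q = l, which removes the logarithm from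
    the second term.\<close>
  define Q where "Q = (\<lambda>z. 1 - Ln (1 - cnj a * z))"
  define P where "P = (\<lambda>z. cnj a / (1 - cnj a * z))"
  have Q: "(Q has_field_derivative P a) (at a)"
    unfolding Q_def P_def using log_base_has_deriv[OF assms assms] .
  have P: "(P has_field_derivative P a ^ 2) (at a)"
    unfolding P_def using mobius_denom(4)[OF assms assms]
    by (auto intro!: derivative_eq_intros simp: power2_eq_square)
  have "deriv (deriv (log_test a)) a =
     deriv (\<lambda>z. 2 * (1 - Ln (1 - cnj a * z)) * (cnj a / (1 - cnj a * z)) / ?l) a"
    by (rule disc_cong_deriv[OF log_test_deriv[OF assms] assms])
  also have "\<dots> = 2 * (cnj a / (1 - cnj a * a)) ^ 2 / ?l
     + 2 * (1 - Ln (1 - cnj a * a)) / ?l * (cnj a / (1 - cnj a * a)) ^ 2"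
    unfolding Q_def[symmetric, THEN fun_cong, simplified] P_def[symmetric, THEN fun_cong, simplified]
    by (rule DERIV_imp_deriv) (use l in \<open>auto intro!: derivative_eq_intros Q P simp: field_simps power2_eq_square\<close>)
  also have "\<dots> = (cnj a / of_real ?s) ^ 2 * (2 / ?l + 2)"
    unfolding ls(2) unfolding ls(1) using l by (simp add: algebra_simps del: of_real_diff)
  finally have "norm (deriv (deriv (log_test a)) a) = norm ((cnj a / of_real ?s) ^ 2 * (2 / ?l + 2))"
    by simp
  also have "\<dots> = (norm a / ?s) ^ 2 * norm (2 / ?l + 2)"
    using s unfolding norm_mult norm_power norm_divide norm_of_real by simp
  also have "\<dots> \<le> (1 / ?s) ^ 2 * (2 / 1 + 2)"
  proof (intro mult_mono power_mono divide_right_mono norm_triangle_le add_mono)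
    show "norm (2 / ?l) \<le> 2 / 1"
      using lgw_ge[OF assms] by (simp add: norm_divide divide_le_eq)
  qed (use a1 s in auto)
  finally show "norm (deriv (deriv (log_test a)) a) \<le> 4 / ?s ^ 2"
    by (simp add: power_divide)
qed

text \<open>The 6 is 1 for the constant term, 4 as a bound for the argument, and 1 from |ln |D||
  \<le> 1 - ln y, which holds because y \<le> |D| \<le> 2 and y \<le> 1, where D = 1 - cnj a
  z.\<close>

lemma log_base_norm_le:
  assumes "a \<in> disc" "z \<in> disc" and y: "0 < y" "y \<le> norm (1 - cnj a * z)" "y \<le> 1"
  shows "norm (1 - Ln (1 - cnj a * z)) \<le> 6 - ln y"
proof -
  let ?D = "1 - cnj a * z"
  note D = mobius_denom[OF assms(1,2)]
  have "norm (Ln ?D) \<le> \<bar>Re (Ln ?D)\<bar> + \<bar>Im (Ln ?D)\<bar>"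
    by (rule cmod_le)
  moreover have "\<bar>Im (Ln ?D)\<bar> \<le> 4"
    using mpi_less_Im_Ln[OF D(4)] Im_Ln_le_pi[OF D(4)] pi_less_4 by linarith
  moreover have "\<bar>Re (Ln ?D)\<bar> \<le> 1 - ln y"
  proof -
    have "ln y \<le> ln (norm ?D)" using y D(4) by (subst ln_le_cancel_iff) auto
    moreover have "ln (norm ?D) \<le> ln 2" using D(3,4) by (subst ln_le_cancel_iff) auto
    moreover have "ln y \<le> 0" using y by simp
    ultimately show ?thesis
      unfolding Re_Ln[OF D(4)] using ln_2_less_1 by linarith
  qed
  moreover have "norm (1 - Ln ?D) \<le> 1 + norm (Ln ?D)"
    using norm_triangle_ineq4[of 1 "Ln ?D"] by simp
  ultimately show ?thesis by linarith
qed

text \<open>The bounds x and d stay open because they are chosen in three ways: d = 1 - |z| for the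
  Bloch estimate, d = 1 - |a| for boundedness with a fixed, and d depending only on s for decay on
  |z| \<le> s.\<close>

lemma log_test_deriv_le:
  assumes "a \<in> disc" "z \<in> disc" "norm (1 - Ln (1 - cnj a * z)) \<le> x" "0 < d" "d \<le> norm (1 - cnj a * z)"
  shows "norm (deriv (log_test a) z) \<le> 2 * x / (d * lgw a)"
proof -
  have "norm (deriv (log_test a) z) = 2 * (norm (1 - Ln (1 - cnj a * z)) * norm a) / (norm (1 - cnj a * z) * lgw a)"
    unfolding log_test_deriv[OF assms(1,2)] using lgw_ge[OF assms(1)]
    by (simp add: norm_mult norm_divide del: right_diff_distrib_numeral)
  also have "\<dots> \<le> 2 * (x * 1) / (d * lgw a)"
    using assms lgw_ge[OF assms(1)] order_trans[OF norm_ge_zero assms(3)]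
    by (intro frac_le mult_mono mult_pos_pos) auto
  finally show ?thesis by simp
qed

lemma log_base_le_lgw:
  assumes "a \<in> disc" "z \<in> disc"
  shows "norm (1 - Ln (1 - cnj a * z)) \<le> 7 * lgw a"
proof -
  let ?s = "1 - norm a ^ 2"
  have s: "?s > 0" using one_minus_sq_pos[OF assms(1)] .
  \<comment> \<open>Half of 1 - |a|^2 is at most 1 - |a|, hence at most the modulus of the
    denominator. The surplus 5 + ln 2 is absorbed because \<open>lgw a\<close> \<ge> 1.\<close>
  have "norm (1 - Ln (1 - cnj a * z)) \<le> 6 - ln (?s / 2)"
  proof (rule log_base_norm_le[OF assms])
    show "?s / 2 \<le> norm (1 - cnj a * z)"
      using mobius_denom(2)[OF assms] one_minus_sq_le[of "norm a"] assms(1) by simp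
    show "?s / 2 \<le> 1"
      by (rule order_trans[of _ "1 / 2"]) auto
  qed (use s in simp)
  also have "\<dots> = 5 + lgw a + ln 2"
    using s by (simp add: ln_div lgw_def)
  also have "\<dots> \<le> 7 * lgw a"
    using ln_2_less_1 lgw_ge[OF assms(1)] by linarith
  finally show ?thesis .
qed

section \<open>Lower bound for the essential norm\<close>

lemma kern_poly_bloch:
  assumes "a \<in> disc" "z \<in> disc"
  shows "(1 - norm z ^ 2) * norm (deriv (kern_poly b c a) z) \<le> 4 * (1 + 4 * norm b + 12 * norm c)"
proof -
  have "(1 - norm z ^ 2) * norm (deriv (kern_poly b c a) z)
    \<le> (2 * (1 - norm z)) * (2 / (1 - norm z) * (1 + 4 * norm b + 12 * norm c))"
    using assms kern_norm_le(1)[OF assms] one_minus_sq_le[of "norm z"]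
    by (intro mult_mono order_trans[OF kern_poly_deriv_le[OF assms]] divide_right_mono) auto
  also have "\<dots> = 4 * (1 + 4 * norm b + 12 * norm c)"
    using assms by (simp add: field_simps)
  finally show ?thesis .
qed

lemma kern_poly_null:
  assumes "s < 1" "e > 0"
  shows "\<exists>t<1. \<forall>a\<in>disc. t < norm a \<longrightarrow> norm (kern_poly b c a 0) < e \<and>
     (\<forall>z\<in>disc. norm z \<le> s \<longrightarrow> norm (deriv (kern_poly b c a) z) \<le> e)"
proof -
  define M where "M = 1 + 4 * norm b + 12 * norm c"
  \<comment> \<open>For negative s there is no z to consider, but the estimate at 0 still uses d
    \<le> 1; hence the maximum with 0.\<close>
  define d where "d = 1 - max s 0"
  have M: "M \<ge> 1" and d: "0 < d" "d \<le> 1"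
    using assms by (auto simp: M_def d_def)
  \<comment> \<open>The threshold |a| > 1 - \<eta>/2 forces 1 - |a|^2 < \<eta>, and then the
    derivative bound (1 - |a|^2) M / d^2 is below e.\<close>
  define \<eta> where "\<eta> = e * d ^ 2 / M"
  have \<eta>: "\<eta> > 0" using assms M d by (simp add: \<eta>_def)
  show ?thesis
  proof (intro exI[of _ "1 - \<eta> / 2"] conjI ballI impI)
    fix a :: complex assume a: "a \<in> disc" "1 - \<eta> / 2 < norm a"
    then have "2 * (1 - norm a) < \<eta>" by (simp add: field_simps)
    then have s: "1 - norm a ^ 2 < \<eta>"
      using a one_minus_sq_le[of "norm a"] by simp
    then have sM: "(1 - norm a ^ 2) * M < e * d ^ 2"
      using M by (simp add: \<eta>_def field_simps)
    have "e * d ^ 2 \<le> e * 1"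
      using assms d by (intro mult_left_mono) (auto simp: power_le_one)
    then show "norm (kern_poly b c a 0) < e"
      using kern_poly_0_le[OF a(1), of b c] sM unfolding M_def by linarith
    fix z :: complex assume z: "z \<in> disc" "norm z \<le> s"
    have dz: "d \<le> 1 - norm z" using z by (auto simp: d_def)
    have "norm (deriv (kern_poly b c a) z) \<le> norm (kern a z) / (1 - norm z) * M"
      unfolding M_def by (rule kern_poly_deriv_le[OF a(1) z(1)])
    also have "\<dots> \<le> (1 - norm a ^ 2) / (1 - norm z) / (1 - norm z) * M"
      using kern_norm_le(2)[OF a(1) z(1)] z M by (intro mult_right_mono divide_right_mono) auto
    also have "\<dots> = (1 - norm a ^ 2) * M / (1 - norm z) ^ 2"
      by (simp add: power2_eq_square)
    also have "\<dots> \<le> (e * d ^ 2) / d ^ 2"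
      using sM dz d one_minus_sq_pos[OF a(1)] M assms
      by (intro frac_le power_mono mult_nonneg_nonneg) auto
    also have "\<dots> = e" using d by simp
    finally show "norm (deriv (kern_poly b c a) z) \<le> e" .
  qed (use \<eta> in auto)
qed

lemma log_test_bloch:
  assumes "a \<in> disc" "z \<in> disc"
  shows "(1 - norm z ^ 2) * norm (deriv (log_test a) z) \<le> 28"
proof -
  have "norm (deriv (log_test a) z) \<le> 2 * (7 * lgw a) / ((1 - norm z) * lgw a)"
    using assms mobius_denom[OF assms] by (intro log_test_deriv_le log_base_le_lgw) auto
  also have "\<dots> = 14 / (1 - norm z)"
    using lgw_ge[OF assms(1)] by simp
  finally have "(1 - norm z ^ 2) * norm (deriv (log_test a) z) \<le> (2 * (1 - norm z)) * (14 / (1 - norm z))"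
    using assms one_minus_sq_le[of "norm z"] by (intro mult_mono) auto
  also have "\<dots> = 28"
    using assms by (simp add: field_simps)
  finally show ?thesis .
qed

text \<open>At 0 the value is 1/\<open>lgw a\<close>, and on |z| \<le> s the derivative is at most a
  constant over \<open>lgw a\<close>. The number X in the proof records how large
  \<open>lgw a\<close> must be for both to fall below e.\<close>

lemma log_test_null:
  assumes "s < 1" "e > 0"
  shows "\<exists>t<1. \<forall>a\<in>disc. t < norm a \<longrightarrow> norm (log_test a 0) < e \<and>
     (\<forall>z\<in>disc. norm z \<le> s \<longrightarrow> norm (deriv (log_test a) z) \<le> e)"
proof -
  define d where "d = 1 - max s 0"
  have d: "0 < d" "d \<le> 1"
    using assms by (auto simp: d_def)
  define X where "X = max (1 / e) (2 * (6 - ln d) / (d * e))"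
  show ?thesis
  proof (intro exI[of _ "1 - exp (- X) / 2"] conjI ballI impI)
    fix a :: complex assume a: "a \<in> disc" "1 - exp (- X) / 2 < norm a"
    then have "2 * (1 - norm a) < exp (- X)" by (simp add: field_simps)
    then have s: "1 - norm a ^ 2 < exp (- X)"
      using a one_minus_sq_le[of "norm a"] by simp
    then have "ln (1 - norm a ^ 2) < ln (exp (- X))"
      using one_minus_sq_pos[OF a(1)] by (subst ln_less_cancel_iff) auto
    then have lX: "lgw a > X" by (simp add: lgw_def)
    then have l: "1 / e < lgw a" "2 * (6 - ln d) / (d * e) < lgw a"
      by (auto simp: X_def)
    note l1 = lgw_ge[OF a(1)]
    show "norm (log_test a 0) < e"
      using l(1) l1 assms by (simp add: log_test_def norm_divide field_simps)
    fix z :: complex assume z: "z \<in> disc" "norm z \<le> s"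
    have "d \<le> 1 - norm z" using z by (auto simp: d_def)
    then have dz: "d \<le> norm (1 - cnj a * z)"
      using mobius_denom(1)[OF a(1) z(1)] by linarith
    have "norm (deriv (log_test a) z) \<le> 2 * (6 - ln d) / (d * lgw a)"
      using d dz by (intro log_test_deriv_le log_base_norm_le a z) auto
    also have "\<dots> \<le> e"
      using l(2) l1 d assms by (simp add: field_simps)
    finally show "norm (deriv (log_test a) z) \<le> e" .
  qed simp
qed

context weighted_composition
begin

text \<open>The 16 is the factor 4 of \<open>ess_test_family\<close> times the factor 4 of
  \<open>kern_poly_bloch\<close>.\<close>

lemma kern_poly_ess:
  assumes e: "e > 0"
  shows "\<exists>s<1. \<forall>z\<in>disc. s < norm (\<phi> z) \<longrightarrow>
     wt \<beta> z * norm (deriv (deriv (wcomp u \<phi> (kern_poly b c (\<phi> z)))) z)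
       \<le> 16 * (1 + 4 * norm b + 12 * norm c) * (ess + e)"
proof -
  define M where "M = 1 + 4 * norm b + 12 * norm c"
  have M: "M \<ge> 1" by (simp add: M_def)
  have 1: "norm (kern_poly b c a 0) \<le> 4 * M" if "a \<in> disc" for a
  proof -
    have "norm (kern_poly b c a 0) \<le> (1 - norm a ^ 2) * M"
      unfolding M_def by (rule kern_poly_0_le[OF that])
    also have "\<dots> \<le> 4 * M"
      using M by (intro mult_right_mono order_trans[of "1 - norm a ^ 2" 1 4]) auto
    finally show ?thesis .
  qed
  \<comment> \<open>This bound may blow up as |a| tends to 1: the gliding hump asks only for
    finiteness, one function at a time.\<close>
  have 2: "\<exists>B. \<forall>z\<in>disc. norm (deriv (kern_poly b c a) z) \<le> B" if a: "a \<in> disc" for a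
  proof (intro exI ballI)
    fix z assume z: "z \<in> disc"
    let ?s = "1 - norm a ^ 2"
    have s: "?s > 0" by (rule one_minus_sq_pos[OF a])
    have n: "norm (1 + 2 * b * kern a z + 3 * c * kern a z ^ 2) \<le> M"
    proof -
      have "norm (1 + 2 * b * kern a z + 3 * c * kern a z ^ 2) \<le>
        1 + 2 * norm b * norm (kern a z) + 3 * norm c * norm (kern a z) ^ 2"
        by (intro norm_triangle_le add_mono) (auto simp: norm_mult norm_power)
      also have "\<dots> \<le> 1 + 2 * norm b * 2 + 3 * norm c * 2 ^ 2"
        using kern_norm_le(1)[OF a z] by (intro add_mono mult_left_mono power_mono) auto
      finally show ?thesis by (simp add: M_def)
    qed
    show "norm (deriv (kern_poly b c a) z) \<le> norm (cnj a / of_real ?s) * 2 ^ 2 * M"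
      unfolding kern_poly_deriv[OF a z] norm_mult[of "_ * _ ^ 2"] norm_mult[of _ "_ ^ 2"] norm_power
      using kern_norm_le(1)[OF a z] n by (intro mult_mono power_mono mult_nonneg_nonneg) auto
  qed
  have "\<exists>s<1. \<forall>z\<in>disc. s < norm (\<phi> z) \<longrightarrow>
     wt \<beta> z * norm (deriv (deriv (wcomp u \<phi> (kern_poly b c (\<phi> z)))) z) \<le> 4 * (4 * M) * (ess + e)"
  proof (intro ess_test_family kern_poly_holo 1 2 kern_poly_null e)
    show "(1 - norm z ^ 2) * norm (deriv (kern_poly b c a) z) \<le> 4 * M" if "a \<in> disc" "z \<in> disc" for a z
      unfolding M_def by (rule kern_poly_bloch[OF that])
  qed (use M in auto)
  then show ?thesis by (simp add: M_def)
qed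

lemma log_test_ess:
  assumes e: "e > 0"
  shows "\<exists>s<1. \<forall>z\<in>disc. s < norm (\<phi> z) \<longrightarrow>
     wt \<beta> z * norm (deriv (deriv (wcomp u \<phi> (log_test (\<phi> z)))) z) \<le> 4 * 28 * (ess + e)"
proof (rule ess_test_family)
  fix a :: complex assume a: "a \<in> disc"
  show "norm (log_test a 0) \<le> 28"
    using lgw_ge[OF a] by (simp add: log_test_def norm_divide divide_le_eq)
  show "\<exists>B. \<forall>z\<in>disc. norm (deriv (log_test a) z) \<le> B"
    using a mobius_denom[OF a]
    by (intro exI[of _ "2 * (7 * lgw a) / ((1 - norm a) * lgw a)"] ballI log_test_deriv_le log_base_le_lgw) auto
qed (use e in \<open>auto intro: log_test_holo log_test_bloch log_test_null simp del: mem_ball\<close>)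

text \<open>The constants accumulate along the elimination: 336 = 16 * 21 and 80 = 16 * 5 from
  \<open>kern_poly_ess\<close>, 112 = 4 * 28 from \<open>log_test_ess\<close>, and finally 112 + 2 *
  5536 + 4 * 672 = 13872, rounded up to 14000.\<close>

lemma ess_lower:
  assumes e: "e > 0"
  shows "\<exists>s<1. \<forall>z\<in>disc. s < norm (\<phi> z) \<longrightarrow>
     wt \<beta> z * norm (coeff2 u \<phi> z) / (1 - norm (\<phi> z) ^ 2) ^ 2 \<le> 14000 * (ess + e) \<and>
     wt \<beta> z * norm (coeff1 u \<phi> z) / (1 - norm (\<phi> z) ^ 2) \<le> 14000 * (ess + e) \<and>
     wt \<beta> z * norm (deriv (deriv u) z) * lgw (\<phi> z) \<le> 14000 * (ess + e)"
proof -
  obtain s1 where s1: "s1 < 1" "\<And>z. z \<in> disc \<Longrightarrow> s1 < norm (\<phi> z) \<Longrightarrow>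
     wt \<beta> z * norm (deriv (deriv (wcomp u \<phi> (kern_poly (-2) 1 (\<phi> z)))) z) \<le> 336 * (ess + e)"
    using kern_poly_ess[OF e, of "-2" 1] by auto
  obtain s2 where s2: "s2 < 1" "\<And>z. z \<in> disc \<Longrightarrow> s2 < norm (\<phi> z) \<Longrightarrow>
     wt \<beta> z * norm (deriv (deriv (wcomp u \<phi> (kern_poly (-1) 0 (\<phi> z)))) z) \<le> 80 * (ess + e)"
    using kern_poly_ess[OF e, of "-1" 0] by auto
  obtain s3 where s3: "s3 < 1" "\<And>z. z \<in> disc \<Longrightarrow> s3 < norm (\<phi> z) \<Longrightarrow>
     wt \<beta> z * norm (deriv (deriv (wcomp u \<phi> (log_test (\<phi> z)))) z) \<le> 112 * (ess + e)"
    using log_test_ess[OF e] by auto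
  show ?thesis
  \<comment> \<open>Derivatives of the rational test functions at a carry factors |a| and |a|^2. For
    |a| > 1/2 these are removed at the cost of 2 and 4.\<close>
  proof (intro exI[of _ "max (1 / 2) (max s1 (max s2 s3))"] conjI ballI impI)
    fix z assume z: "z \<in> disc" and "max (1 / 2) (max s1 (max s2 s3)) < norm (\<phi> z)"
    then have gt: "1 / 2 < norm (\<phi> z)" "s1 < norm (\<phi> z)" "s2 < norm (\<phi> z)" "s3 < norm (\<phi> z)" by auto
    define a where "a = \<phi> z"
    have a: "a \<in> disc" unfolding a_def using phi_in[OF z] .
    have a2: "1 / 2 < norm a" using gt by (simp add: a_def)
    define \<sigma> where "\<sigma> = 1 - norm a ^ 2"
    have \<sigma>: "\<sigma> > 0" unfolding \<sigma>_def by (rule one_minus_sq_pos[OF a])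
    define k where "k = cnj a / of_real \<sigma>"
    have nk: "norm k = norm a / \<sigma>" using \<sigma> by (simp add: k_def norm_divide)
    define E where "E = ess + e"
    have E: "E > 0" using ess_nonneg e by (simp add: E_def)
    define w where "w = wt \<beta> z"
    have w: "w \<ge> 0" by (simp add: w_def)
    define H where "H = w * norm (coeff2 u \<phi> z) / \<sigma> ^ 2"
    define V where "V = w * norm (coeff1 u \<phi> z) / \<sigma>"
    define U where "U = w * norm (deriv (deriv u) z) * lgw a"
    have nn: "H \<ge> 0" "V \<ge> 0" using w \<sigma> by (auto simp: H_def V_def)
    have P1: "deriv (deriv (wcomp u \<phi> (kern_poly (-2) 1 a))) z = coeff2 u \<phi> z * (k ^ 2 * 2)"
      using wcomp_deriv2[OF kern_poly_holo[OF a] z, of "-2" 1] kern_poly_deriv[OF a a, of "-2" 1]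
        kern_poly_deriv2[OF a, of "-2" 1] kern_self[OF a]
      by (simp add: a_def[symmetric] kern_poly_def k_def \<sigma>_def)
    have P2: "deriv (deriv (wcomp u \<phi> (kern_poly (-1) 0 a))) z = coeff1 u \<phi> z * (- k) + coeff2 u \<phi> z * (k ^ 2 * (-4))"
      using wcomp_deriv2[OF kern_poly_holo[OF a] z, of "-1" 0] kern_poly_deriv[OF a a, of "-1" 0]
        kern_poly_deriv2[OF a, of "-1" 0] kern_self[OF a]
      by (simp add: a_def[symmetric] kern_poly_def k_def \<sigma>_def)
    have P3: "deriv (deriv (wcomp u \<phi> (log_test a))) z = deriv (deriv u) z * of_real (lgw a) +
       coeff1 u \<phi> z * deriv (log_test a) a + coeff2 u \<phi> z * deriv (deriv (log_test a)) a"
      using wcomp_deriv2[OF log_test_holo[OF a] z] log_test_self(1)[OF a] by (simp add: a_def[symmetric])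
    have "2 * H * norm a ^ 2 \<le> 336 * E"
      using s1(2)[OF z gt(2)] unfolding a_def[symmetric] P1 norm_mult norm_power nk E_def[symmetric] w_def[symmetric]
      by (simp add: H_def power_divide mult_ac)
    moreover have "H * (1 / 4) \<le> H * norm a ^ 2"
      using a2 nn power_mono[of "1/2" "norm a" 2] by (intro mult_left_mono) (auto simp: power2_eq_square)
    ultimately have H: "H \<le> 672 * E" by linarith
    \<comment> \<open>From V/2 \<le> 80 E + 4 H and H \<le> 672 E: 5536 = 160 + 8 * 672.\<close>
    have V: "V \<le> 5536 * E"
    proof -
      have "norm (coeff1 u \<phi> z * k) \<le> norm (deriv (deriv (wcomp u \<phi> (kern_poly (-1) 0 a))) z) + norm (coeff2 u \<phi> z * (k ^ 2 * 4))"
        unfolding P2 by (metis (no_types, opaque_lifting) add.commute mult_minus_right norm_minus_cancel norm_triangle_sub uminus_add_conv_diff)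
      then have "w * norm (coeff1 u \<phi> z * k) \<le> w * (norm (deriv (deriv (wcomp u \<phi> (kern_poly (-1) 0 a))) z) + norm (coeff2 u \<phi> z * (k ^ 2 * 4)))"
        by (intro mult_left_mono w)
      also have "\<dots> \<le> 80 * E + w * norm (coeff2 u \<phi> z * (k ^ 2 * 4))"
        using s2(2)[OF z gt(3)] unfolding a_def[symmetric] E_def[symmetric] w_def[symmetric]
        by (simp add: distrib_left)
      also have "w * norm (coeff2 u \<phi> z * (k ^ 2 * 4)) = 4 * H * norm a ^ 2"
        unfolding norm_mult norm_power nk by (simp add: H_def power_divide)
      also have "w * norm (coeff1 u \<phi> z * k) = V * norm a"
        unfolding norm_mult nk by (simp add: V_def)
      finally have "V * norm a \<le> 80 * E + 4 * H * norm a ^ 2" .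
      moreover have "V * (1 / 2) \<le> V * norm a"
        using a2 nn by (intro mult_left_mono) auto
      moreover have "4 * H * norm a ^ 2 \<le> 4 * H * 1"
        using a nn by (intro mult_left_mono) (auto simp: power_le_one)
      ultimately show ?thesis using H by linarith
    qed
    have U: "U \<le> 14000 * E"
    proof -
      let ?D = "deriv (deriv (wcomp u \<phi> (log_test a))) z"
      let ?x = "coeff1 u \<phi> z * deriv (log_test a) a" and ?y = "coeff2 u \<phi> z * deriv (deriv (log_test a)) a"
      have "deriv (deriv u) z * of_real (lgw a) = ?D - ?x - ?y"
        by (simp add: P3)
      then have "norm (deriv (deriv u) z * of_real (lgw a)) \<le> norm ?D + norm ?x + norm ?y"
        by (auto intro!: norm_triangle_le_diff add_mono)
      then have "w * norm (deriv (deriv u) z * of_real (lgw a)) \<le> w * (norm ?D + norm ?x + norm ?y)"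
        by (intro mult_left_mono w)
      also have "\<dots> = w * norm ?D + w * norm (coeff1 u \<phi> z) * norm (deriv (log_test a) a)
         + w * norm (coeff2 u \<phi> z) * norm (deriv (deriv (log_test a)) a)"
        by (simp add: norm_mult algebra_simps)
      also have "\<dots> \<le> 112 * E + w * norm (coeff1 u \<phi> z) * (2 / \<sigma>) + w * norm (coeff2 u \<phi> z) * (4 / \<sigma> ^ 2)"
        using s3(2)[OF z gt(4)] log_test_self[OF a] w unfolding a_def[symmetric] E_def[symmetric] w_def[symmetric] \<sigma>_def[symmetric]
        by (intro add_mono mult_left_mono) auto
      also have "\<dots> = 112 * E + 2 * V + 4 * H"
        by (simp add: V_def H_def mult_ac)
      finally have "U \<le> 112 * E + 2 * V + 4 * H"
        using lgw_ge[OF a] by (simp add: U_def norm_mult)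
      then show ?thesis using H V E by linarith
    qed
    have H': "H \<le> 14000 * E" and V': "V \<le> 14000 * E"
      using H V E by linarith+
    show "wt \<beta> z * norm (coeff2 u \<phi> z) / (1 - norm (\<phi> z) ^ 2) ^ 2 \<le> 14000 * (ess + e)"
      using H' unfolding H_def w_def \<sigma>_def a_def E_def .
    show "wt \<beta> z * norm (coeff1 u \<phi> z) / (1 - norm (\<phi> z) ^ 2) \<le> 14000 * (ess + e)"
      using V' unfolding V_def w_def \<sigma>_def a_def E_def .
    show "wt \<beta> z * norm (deriv (deriv u) z) * lgw (\<phi> z) \<le> 14000 * (ess + e)"
      using U unfolding U_def w_def a_def E_def .
  qed (use s1(1) s2(1) s3(1) in auto)
qed

end

section \<open>Elementary inequalities for powers against weights\<close>

lemma power_mult_one_minus_le: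
  fixes x :: real
  assumes "0 \<le> x" "x < 1"
  shows "(real n + 1) * x ^ n * (1 - x) \<le> 1"
proof -
  \<comment> \<open>Each of the n + 1 terms of the geometric sum is at least its last one.\<close>
  have "(real n + 1) * x ^ n = (\<Sum>k<Suc n. x ^ n)" by simp
  also have "\<dots> \<le> (\<Sum>k<Suc n. x ^ k)"
    using assms by (intro sum_mono power_decreasing) auto
  finally have "(real n + 1) * x ^ n * (1 - x) \<le> (\<Sum>k<Suc n. x ^ k) * (1 - x)"
    using assms by (intro mult_right_mono) auto
  also have "\<dots> = 1 - x ^ Suc n"
    using one_diff_power_eq[of x "Suc n"] by (simp only: mult.commute)
  also have "\<dots> \<le> 1" using assms by simp
  finally show ?thesis .
qed

text \<open>Apply \<open>power_mult_one_minus_le\<close> to y, the square root of x, and square. As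
  1 - x^2 = 1 - y^4 \<le> 4(1 - y), the constant is 4^2.\<close>

lemma power_mult_one_minus_sq_le:
  fixes x :: real
  assumes "0 \<le> x" "x < 1"
  shows "(real n + 1) ^ 2 * x ^ n * (1 - x ^ 2) ^ 2 \<le> 16"
proof -
  define y where "y = sqrt x"
  have y: "0 \<le> y" "y < 1" and x: "x = y ^ 2"
    using assms by (auto simp: y_def)
  have "1 - x ^ 2 = (1 - y) * ((1 + y) * (1 + y ^ 2))"
    by (simp add: x algebra_simps power2_eq_square)
  also have "\<dots> \<le> (1 - y) * (2 * 2)"
    using y by (intro mult_left_mono mult_mono) (auto simp: power_le_one)
  finally have 1: "1 - x ^ 2 \<le> 4 * (1 - y)" by simp
  have "(real n + 1) * y ^ n * (1 - x ^ 2) \<le> (real n + 1) * y ^ n * (4 * (1 - y))"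
    using y 1 by (intro mult_left_mono) auto
  also have "\<dots> \<le> 4"
    using power_mult_one_minus_le[OF y, of n] by (simp only: mult.left_commute[of _ 4])
  finally have "((real n + 1) * y ^ n * (1 - x ^ 2)) ^ 2 \<le> 4 ^ 2"
    using assms y by (intro power_mono) (auto simp: power_le_one)
  then show ?thesis
    by (simp add: x power_mult_distrib power_mult[symmetric] mult.commute)
qed

text \<open>With s = 1 - |a|^2, writing ln n = ln(n s) - ln s \<le> n s - ln s turns the logarithm
  into n s, and n s |a|^n \<le> 2 by \<open>power_mult_one_minus_le\<close>.\<close>

lemma ln_mult_power_le:
  assumes a: "a \<in> disc"
  shows "ln (real n) * norm a ^ n \<le> 2 * lgw a"
proof (cases "n = 0")
  case True
  then show ?thesis using lgw_ge[OF a] by simp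
next
  case False
  define x where "x = norm a"
  have x: "0 \<le> x" "x < 1" using a by (auto simp: x_def)
  define s where "s = 1 - x ^ 2"
  have s: "s > 0" "s \<le> 2 * (1 - x)" using one_minus_sq_pos[OF a] one_minus_sq_le[OF x] by (auto simp: s_def x_def)
  have p: "0 \<le> x ^ n" "x ^ n \<le> 1" using x by (auto simp: power_le_one)
  have "ln (real n) = ln (real n * s) - ln s"
    using s False by (simp add: ln_mult)
  also have "\<dots> \<le> real n * s - ln s"
    using ln_le_minus_one[of "real n * s"] s False by simp
  finally have "ln (real n) * x ^ n \<le> (real n * s - ln s) * x ^ n"
    using p by (intro mult_right_mono) auto
  also have "\<dots> = real n * x ^ n * s + (- ln s) * x ^ n"
    by (simp add: algebra_simps)
  also have "\<dots> \<le> (real n + 1) * x ^ n * (2 * (1 - x)) + (- ln s) * 1"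
    using s p x by (intro add_mono mult_mono mult_left_mono) (auto simp: s_def)
  also have "\<dots> \<le> 2 - ln s"
    using power_mult_one_minus_le[OF x, of n] by (simp only: mult.left_commute[of _ 2])
  also have "\<dots> \<le> 2 * lgw a"
    using s by (simp add: lgw_def s_def x_def)
  finally show ?thesis by (simp add: x_def)
qed

section \<open>Powers, dilations and growth of Bloch functions\<close>

text \<open>The sequence is the square of (n+1) y^n with y the square root of s.\<close>

lemma sq_times_power_tendsto_0:
  fixes s :: real
  assumes "0 \<le> s" "s < 1"
  shows "(\<lambda>n. (real n + 1) ^ 2 * s ^ n) \<longlonglongrightarrow> 0"
proof -
  define y where "y = sqrt s"
  have y: "0 \<le> y" "y < 1" and s: "s = y ^ 2"
    using assms by (auto simp: y_def)
  have "(\<lambda>n. (real n * y ^ n + y ^ n) ^ 2) \<longlonglongrightarrow> (0 + 0) ^ 2"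
    using y by (intro tendsto_intros powser_times_n_limit_0 LIMSEQ_power_zero) auto
  moreover have "(real n * y ^ n + y ^ n) ^ 2 = (real n + 1) ^ 2 * s ^ n" for n
  proof -
    have "(real n * y ^ n + y ^ n) ^ 2 = ((real n + 1) * y ^ n) ^ 2"
      by (simp add: distrib_right)
    also have "\<dots> = (real n + 1) ^ 2 * s ^ n"
      by (simp add: s power_mult_distrib mult.commute flip: power_mult)
    finally show ?thesis .
  qed
  ultimately show ?thesis by simp
qed

text \<open>Where |\<phi>| \<le> s, the geometric decay of the powers beats every weight up to
  (n+1)^2, so for large n this part costs at most d. Only the region |\<phi>| > s determines the
  limsup.\<close>

lemma limsup_nu_norm_le:
  assumes g: "\<And>z. z \<in> disc \<Longrightarrow> wt \<beta> z * norm (g z) \<le> B"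
    and c: "\<And>n. 0 \<le> c n" "\<And>n. c n \<le> (real n + 1) ^ 2"
    and s: "s < 1" and d: "d > 0" and L: "L \<ge> 0"
    and far: "\<And>n z. z \<in> disc \<Longrightarrow> s < norm (\<phi> z) \<Longrightarrow> c n * norm (\<phi> z) ^ n * (wt \<beta> z * norm (g z)) \<le> L"
  shows "limsup (\<lambda>n. ereal (c n) * nu_norm \<beta> (\<lambda>z. g z * \<phi> z ^ n)) \<le> ereal (L + d)"
proof (rule Limsup_bounded)
  define s' where "s' = max s 0"
  have s': "0 \<le> s'" "s' < 1" using s by (auto simp: s'_def)
  have B: "B \<ge> 0" using order_trans[OF _ g[of 0]] by simp
  have "(\<lambda>n. (real n + 1) ^ 2 * s' ^ n * B) \<longlonglongrightarrow> 0 * B"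
    by (intro tendsto_mult sq_times_power_tendsto_0 s' tendsto_const)
  then have "\<forall>\<^sub>F n in sequentially. (real n + 1) ^ 2 * s' ^ n * B < d"
    using d by (intro order_tendstoD(2)) auto
  then show "\<forall>\<^sub>F n in sequentially. ereal (c n) * nu_norm \<beta> (\<lambda>z. g z * \<phi> z ^ n) \<le> ereal (L + d)"
  proof (rule eventually_mono)
    fix n assume n: "(real n + 1) ^ 2 * s' ^ n * B < d"
    show "ereal (c n) * nu_norm \<beta> (\<lambda>z. g z * \<phi> z ^ n) \<le> ereal (L + d)"
    \<comment> \<open>The weight ln n vanishes at n = 1, and the main case divides by
      \<open>c n\<close>.\<close>
    proof (cases "c n = 0")
      case True
      then show ?thesis using L d by (simp flip: zero_ereal_def)
    next
      case False
      then have cn: "c n > 0" using c(1)[of n] by simp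
      have pt: "c n * (wt \<beta> z * norm (g z * \<phi> z ^ n)) \<le> L + d" if z: "z \<in> disc" for z
      proof (cases "s < norm (\<phi> z)")
        case True
        then show ?thesis
          using far[OF z True, of n] d by (simp add: norm_mult norm_power mult_ac)
      next
        case False
        have "c n * (wt \<beta> z * norm (g z * \<phi> z ^ n)) = c n * norm (\<phi> z) ^ n * (wt \<beta> z * norm (g z))"
          by (simp add: norm_mult norm_power mult_ac)
        also have "\<dots> \<le> (real n + 1) ^ 2 * s' ^ n * B"
          using False c[of n] g[OF z] s'
          by (intro mult_mono power_mono) (auto simp: s'_def)
        finally show ?thesis using n L by simp
      qed
      have "nu_norm \<beta> (\<lambda>z. g z * \<phi> z ^ n) \<le> ereal ((L + d) / c n)"
        unfolding nu_norm_def using pt cn by (intro SUP_least) (auto simp: field_simps)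
      then have "ereal (c n) * nu_norm \<beta> (\<lambda>z. g z * \<phi> z ^ n) \<le> ereal (c n) * ereal ((L + d) / c n)"
        using cn by (intro ereal_mult_left_mono) auto
      then show ?thesis using cn by simp
    qed
  qed
qed

text \<open>The threshold on n is uniform in z, which later permits n to be chosen in terms of
  z.\<close>

lemma limsup_nu_norm_pointwise:
  assumes "limsup (\<lambda>n. ereal (c n) * nu_norm \<beta> (\<lambda>z. g z * \<phi> z ^ n)) < ereal L"
    and c: "\<And>n. 0 \<le> c n"
  shows "\<forall>\<^sub>F n in sequentially. \<forall>z\<in>disc. c n * norm (\<phi> z) ^ n * (wt \<beta> z * norm (g z)) \<le> L"
  using Limsup_lessD[OF assms(1)]
proof (rule eventually_mono, intro ballI)
  fix n z assume n: "ereal (c n) * nu_norm \<beta> (\<lambda>z. g z * \<phi> z ^ n) < ereal L" and z: "z \<in> disc"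
  have "ereal (c n) * ereal (wt \<beta> z * norm (g z * \<phi> z ^ n)) \<le> ereal (c n) * nu_norm \<beta> (\<lambda>z. g z * \<phi> z ^ n)"
    unfolding nu_norm_def using c z by (intro ereal_mult_left_mono SUP_upper) auto
  also note n
  finally show "c n * norm (\<phi> z) ^ n * (wt \<beta> z * norm (g z)) \<le> L"
    by (simp add: norm_mult norm_power mult_ac)
qed

text \<open>Take n as the integer part of 1/(2(1-x)). It is small enough for Bernoulli to give x^n
  \<ge> 1 - n(1-x) \<ge> 1/2 and large enough to be comparable to 1/(1-x). The assumption on x makes
  n at least N + 3.\<close>

lemma power_choice:
  fixes x :: real
  assumes "0 \<le> x" "x < 1" "1 - 1 / (2 * (real N + 3)) \<le> x"
  obtains n where "n \<ge> N" "n \<ge> 3" "x ^ n \<ge> 1 / 2" "1 / (1 - x) \<le> 2 * (real n + 1)"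
proof -
  define y where "y = 1 / (2 * (1 - x))"
  have "2 * (real N + 3) * (1 - x) \<le> 1"
    using assms by (simp add: field_simps)
  then have y: "y \<ge> real N + 3" "y \<ge> 0" "2 * (1 - x) * y = 1"
    using assms by (simp_all add: y_def field_simps)
  define n where "n = nat \<lfloor>y\<rfloor>"
  have n: "real n \<le> y" "y \<le> real n + 1"
    using y unfolding n_def by linarith+
  have "real (N + 3) \<le> y" using y by simp
  then have N: "N + 3 \<le> n" unfolding n_def by (simp add: le_nat_floor)
  have "1 + real n * (x - 1) \<le> (1 + (x - 1)) ^ n"
    using assms by (intro Bernoulli_inequality) auto
  moreover have "real n * (1 - x) \<le> y * (1 - x)"
    using n assms by (intro mult_right_mono) auto
  ultimately have "x ^ n \<ge> 1 / 2"
    using y(3) by (simp add: algebra_simps)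
  moreover have "1 / (1 - x) = 2 * y" using assms by (simp add: y_def field_simps)
  ultimately show thesis
    using that[of n] N n by auto
qed

text \<open>For n \<ge> 3 one has 1/(1-x) \<le> 2(n+1) \<le> 3n \<le> n^2, which gives 2 ln n; the
  remaining 1 is at most ln n because e \<le> 3.\<close>

lemma log_choice:
  fixes x :: real
  assumes "0 \<le> x" "x < 1" "n \<ge> 3" "1 / (1 - x) \<le> 2 * (real n + 1)"
  shows "1 - ln (1 - x) \<le> 3 * ln (real n)"
proof -
  have "exp 1 \<le> real n" using assms(3) exp_le by linarith
  then have "1 \<le> ln (real n)"
    using assms(3) by (subst ln_ge_iff) auto
  moreover have "- ln (1 - x) = ln (1 / (1 - x))"
    using assms by (simp add: ln_div)
  moreover have "ln (1 / (1 - x)) \<le> ln (real n * real n)"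
  proof -
    have "2 * (real n + 1) \<le> 3 * real n" using assms(3) by simp
    also have "\<dots> \<le> real n * real n" using assms(3) by (intro mult_right_mono) auto
    finally show ?thesis using assms by (subst ln_le_cancel_iff) auto
  qed
  moreover have "ln (real n * real n) = 2 * ln (real n)"
    using assms(3) by (simp add: ln_mult)
  ultimately show ?thesis by linarith
qed

section \<open>Cauchy estimates and dilations\<close>

lemma cauchy_deriv_bounds:
  assumes F: "F holomorphic_on disc" and st: "s < t" "t < 1" and w: "norm w \<le> s"
    and bd: "\<And>w. norm w \<le> t \<Longrightarrow> norm (F w) < \<delta>"
  shows "norm (deriv F w) \<le> \<delta> / (t - s)" "norm (deriv (deriv F) w) \<le> 2 * \<delta> / (t - s) ^ 2"
proof -
  have *: "norm v \<le> t" if "dist w v \<le> t - s" for v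
    using that w norm_triangle_sub[of v w] by (simp add: dist_norm norm_minus_commute)
  have sub: "cball w (t - s) \<subseteq> disc"
    using * st by fastforce
  have h: "F holomorphic_on ball w (t - s)"
    using F sub by (meson ball_subset_cball holomorphic_on_subset)
  have c: "continuous_on (cball w (t - s)) F"
    using F sub holomorphic_on_imp_continuous_on holomorphic_on_subset by blast
  \<comment> \<open>The Cauchy bound is stated for maps into an open ball, which is why
    \<open>bd\<close> is strict.\<close>
  have b: "F v \<in> ball 0 \<delta>" if "v \<in> ball w (t - s)" for v
    using bd[OF *[of v]] that by simp
  show "norm (deriv F w) \<le> \<delta> / (t - s)"
    using Cauchy_higher_deriv_bound[OF h c b, of 1] st by simp
  show "norm (deriv (deriv F) w) \<le> 2 * \<delta> / (t - s) ^ 2"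
    using Cauchy_higher_deriv_bound[OF h c b, of 2] st by (simp add: numeral_2_eq_2)
qed

lemma dilation_has_deriv:
  assumes "f holomorphic_on disc" "0 \<le> \<rho>" "\<rho> \<le> 1" "w \<in> disc"
  shows "((\<lambda>w. f (of_real \<rho> * w)) has_field_derivative of_real \<rho> * deriv f (of_real \<rho> * w)) (at w)"
proof -
  have "norm (of_real \<rho> * w) < 1"
    using assms mult_left_le_one_le[of "norm w" \<rho>] by (simp add: norm_mult)
  then have "(f has_field_derivative deriv f (of_real \<rho> * w)) (at (of_real \<rho> * w))"
    using assms by (intro has_deriv_disc) auto
  moreover have "((\<lambda>w. of_real \<rho> * w) has_field_derivative of_real \<rho>) (at w)"
    by (auto intro!: derivative_eq_intros)
  ultimately show ?thesis
    using DERIV_chain2[of f "deriv f (of_real \<rho> * w)" "\<lambda>w. of_real \<rho> * w" w "of_real \<rho>" UNIV]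
    by (simp add: mult.commute)
qed

lemma dilation_deriv:
  assumes f: "f holomorphic_on disc" "0 \<le> \<rho>" "\<rho> \<le> 1"
  shows "(\<lambda>w. f (of_real \<rho> * w)) holomorphic_on disc"
    "w \<in> disc \<Longrightarrow> deriv (\<lambda>w. f (of_real \<rho> * w)) w = of_real \<rho> * deriv f (of_real \<rho> * w)"
    "w \<in> disc \<Longrightarrow> deriv (deriv (\<lambda>w. f (of_real \<rho> * w))) w = of_real \<rho> ^ 2 * deriv (deriv f) (of_real \<rho> * w)"
proof -
  show "(\<lambda>w. f (of_real \<rho> * w)) holomorphic_on disc"
    using dilation_has_deriv[OF f] by (meson holomorphic_on_open open_ball)
  show 1: "deriv (\<lambda>w. f (of_real \<rho> * w)) w = of_real \<rho> * deriv f (of_real \<rho> * w)" if "w \<in> disc" for w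
    using DERIV_imp_deriv[OF dilation_has_deriv[OF f that]] .
  show "deriv (deriv (\<lambda>w. f (of_real \<rho> * w))) w = of_real \<rho> ^ 2 * deriv (deriv f) (of_real \<rho> * w)"
    if w: "w \<in> disc"
  proof -
    have "deriv (deriv (\<lambda>w. f (of_real \<rho> * w))) w = deriv (\<lambda>w. of_real \<rho> * deriv f (of_real \<rho> * w)) w"
      by (rule disc_cong_deriv[OF 1 w])
    also have "\<dots> = of_real \<rho> * (of_real \<rho> * deriv (deriv f) (of_real \<rho> * w))"
      using w f by (intro DERIV_imp_deriv DERIV_cmult dilation_has_deriv) auto
    finally show ?thesis by (simp add: power2_eq_square)
  qed
qed

section \<open>Pointwise bounds on the Bloch unit ball\<close>

lemma bloch_unit_deriv_le:
  assumes f: "f \<in> bloch" "bloch_norm f \<le> 1" and w: "w \<in> disc"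
  shows "norm (deriv f w) \<le> 1 / (1 - norm w)"
proof -
  have "norm w ^ 2 \<le> norm w"
    using w power_decreasing[of 1 2 "norm w"] by simp
  then have "(1 - norm w) * norm (deriv f w) \<le> (1 - norm w ^ 2) * norm (deriv f w)"
    by (intro mult_right_mono) auto
  also have "\<dots> \<le> 1"
    using bloch_point_le[OF f(1) w] f(2) norm_ge_zero[of "f 0"] by linarith
  finally show ?thesis using w by (simp add: field_simps)
qed

text \<open>Cauchy's estimate for f' on the disc of radius d = (1-|w|)/2 about w: there f' is at
  most 1/d, so f''(w) is at most 1/d^2.\<close>

lemma bloch_unit_deriv2_le:
  assumes f: "f \<in> bloch" "bloch_norm f \<le> 1" and w: "w \<in> disc"
  shows "norm (deriv (deriv f) w) \<le> 4 / (1 - norm w) ^ 2"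
proof -
  define d where "d = (1 - norm w) / 2"
  have d: "d > 0" using w by (simp add: d_def)
  have fh: "f holomorphic_on disc" using f by (simp add: bloch_def)
  have *: "norm v \<le> norm w + dist w v" for v
    using norm_triangle_sub[of v w] by (simp add: dist_norm norm_minus_commute)
  have sub: "cball w d \<subseteq> disc"
  proof
    fix v assume "v \<in> cball w d"
    then show "v \<in> disc"
      using *[of v] w by (simp add: d_def)
  qed
  have h: "deriv f holomorphic_on ball w d"
    using fh sub by (meson ball_subset_cball deriv_holomorphic_disc holomorphic_on_subset)
  have c: "continuous_on (cball w d) (deriv f)"
    using fh sub deriv_holomorphic_disc holomorphic_on_imp_continuous_on holomorphic_on_subset by blast
  have b: "deriv f v \<in> ball 0 (1 / d)" if "v \<in> ball w d" for v
  proof -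
    have v: "norm v < norm w + d" "v \<in> disc"
      using that *[of v] subsetD[OF sub, of v] by simp_all
    then have "norm (deriv f v) \<le> 1 / (1 - norm v)"
      using bloch_unit_deriv_le[OF f] by blast
    also have "\<dots> < 1 / d"
    proof (intro divide_strict_left_mono)
      show "d < 1 - norm v"
        using v(1) by (simp add: d_def field_simps)
    qed (use v d in auto)
    finally show ?thesis by simp
  qed
  have "norm (deriv (deriv f) w) \<le> 1 / d / d"
    using Cauchy_higher_deriv_bound[OF h c b d, of 1] by simp
  also have "\<dots> = 4 / (1 - norm w) ^ 2"
    by (simp add: d_def power2_eq_square)
  finally show ?thesis .
qed

text \<open>Along the radius the derivative of f(tw) in t is at most |w|/(1 - t|w|), the derivative
  of -ln(1 - t|w|). The remaining 1 bounds |f(0)|.\<close>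

lemma bloch_unit_growth:
  assumes f: "f \<in> bloch" "bloch_norm f \<le> 1" and w: "w \<in> disc"
  shows "norm (f w) \<le> 1 - ln (1 - norm w)"
proof -
  have fh: "f holomorphic_on disc" using f by (simp add: bloch_def)
  have in_disc: "of_real t * w \<in> disc" "t * norm w < 1" if "0 \<le> t" "t \<le> 1" for t :: real
    using that w mult_left_le_one_le[of "norm w" t] by (auto simp: norm_mult)
  have der: "((\<lambda>t. f (of_real t * w)) has_vector_derivative w * deriv f (of_real t * w)) (at t)"
    if "0 \<le> t" "t \<le> 1" for t :: real
  proof -
    have "((\<lambda>t. of_real t * w) has_vector_derivative w) (at t)"
      by (auto intro!: derivative_eq_intros simp: has_vector_derivative_def scaleR_conv_of_real)
    from field_vector_diff_chain_at[OF this has_deriv_disc[OF fh in_disc(1)[OF that]]]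
    show ?thesis by (simp add: o_def)
  qed
  have "norm (f (of_real 1 * w) - f (of_real 0 * w)) \<le> (- ln (1 - 1 * norm w)) - (- ln (1 - 0 * norm w))"
  proof (rule differentiable_bound_general[where f = "\<lambda>t. f (of_real t * w)" and \<phi> = "\<lambda>t. - ln (1 - t * norm w)"
        and f' = "\<lambda>t. w * deriv f (of_real t * w)" and \<phi>' = "\<lambda>t. norm w / (1 - t * norm w)"])
    show "continuous_on {0..1} (\<lambda>t. f (of_real t * w))"
      using has_vector_derivative_continuous[OF der] by (intro continuous_at_imp_continuous_on) simp
    show "continuous_on {0..1} (\<lambda>t. - ln (1 - t * norm w))"
      using in_disc(2) by (intro continuous_intros) fastforce
    fix t :: real assume t: "0 < t" "t < 1"
    show "((\<lambda>t. f (of_real t * w)) has_vector_derivative w * deriv f (of_real t * w)) (at t)"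
      using der t by simp
    have t1: "t * norm w < 1" using in_disc(2)[of t] t by simp
    then show "((\<lambda>t. - ln (1 - t * norm w)) has_vector_derivative norm w / (1 - t * norm w)) (at t)"
      unfolding has_real_derivative_iff_has_vector_derivative[symmetric]
      by (auto intro!: derivative_eq_intros)
    have "norm (deriv f (of_real t * w)) \<le> 1 / (1 - norm (of_real t * w))"
      using t by (intro bloch_unit_deriv_le f in_disc) auto
    then have "norm w * norm (deriv f (of_real t * w)) \<le> norm w * (1 / (1 - norm (of_real t * w)))"
      by (intro mult_left_mono) auto
    then show "norm (w * deriv f (of_real t * w)) \<le> norm w / (1 - t * norm w)"
      using t by (simp add: norm_mult)
  qed auto
  then have "norm (f w - f 0) \<le> - ln (1 - norm w)" by simp
  moreover have "norm (f 0) \<le> 1"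
    using bloch_point_le[OF f(1), of 0, simplified] f(2) norm_ge_zero[of "deriv f 0"] by linarith
  moreover have "norm (f w) \<le> norm (f 0) + norm (f w - f 0)"
    by (metis norm_triangle_sub)
  ultimately show ?thesis by linarith
qed

section \<open>Upper bound and the limsup characterization\<close>

context weighted_composition
begin

text \<open>The two values at 0 in the Zygmund norm see F and F' at \<phi>(0); X accounts for the
  second derivative alone.\<close>

lemma wcomp_zyg_norm_le:
  assumes F: "F holomorphic_on disc" and "norm (F (\<phi> 0)) \<le> \<delta>" "norm (deriv F (\<phi> 0)) \<le> \<delta>"
    and pt: "\<And>z. z \<in> disc \<Longrightarrow> wt \<beta> z * norm (deriv (deriv (wcomp u \<phi> F)) z) \<le> X"
  shows "wcomp u \<phi> F \<in> zyg \<beta>"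
    "zyg_norm \<beta> (wcomp u \<phi> F) \<le> (norm (u 0) + norm (deriv u 0) + norm (u 0 * deriv \<phi> 0)) * \<delta> + X"
proof -
  show "wcomp u \<phi> F \<in> zyg \<beta>"
    by (rule zygI(1)[OF wcomp_holo[OF F] pt])
  have "norm (wcomp u \<phi> F 0) \<le> norm (u 0) * \<delta>"
    using assms(2) by (simp add: wcomp_def norm_mult mult_left_mono)
  moreover have "norm (deriv (wcomp u \<phi> F) 0) \<le> norm (deriv u 0) * \<delta> + norm (u 0 * deriv \<phi> 0) * \<delta>"
  proof -
    have "deriv (wcomp u \<phi> F) 0 = deriv u 0 * F (\<phi> 0) + (u 0 * deriv \<phi> 0) * deriv F (\<phi> 0)"
      using wcomp_deriv[OF F, of 0] by simp
    also have "norm \<dots> \<le> norm (deriv u 0) * \<delta> + norm (u 0 * deriv \<phi> 0) * \<delta>"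
      unfolding norm_mult[of "deriv u 0"] norm_mult[of "u 0 * deriv \<phi> 0"]
      using assms(2,3) by (intro norm_triangle_le add_mono) (auto simp: norm_mult[of "deriv u 0"] norm_mult[of "u 0 * deriv \<phi> 0"] intro!: mult_left_mono)
    finally show ?thesis .
  qed
  ultimately show "zyg_norm \<beta> (wcomp u \<phi> F) \<le> (norm (u 0) + norm (deriv u 0) + norm (u 0 * deriv \<phi> 0)) * \<delta> + X"
    using zygI(2)[OF wcomp_holo[OF F] pt] by (simp add: algebra_simps)
qed

section \<open>Dilated operators as compact approximants\<close>

definition dil :: "real \<Rightarrow> (complex \<Rightarrow> complex) \<Rightarrow> complex \<Rightarrow> complex" where
  "dil \<rho> f = wcomp u \<phi> (\<lambda>w. f (of_real \<rho> * w))"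

text \<open>The dilated operator sees f only on |w| \<le> \<rho>, and Cauchy estimates from the
  larger radius (1+\<rho>)/2 bound f' and f'' there. Holomorphy alone is assumed because the lemma
  is also applied to a Montel limit.\<close>

lemma dil_norm_le:
  assumes \<rho>: "0 \<le> \<rho>" "\<rho> < 1"
  obtains A where "A \<ge> 0" "\<And>f \<delta>. f holomorphic_on disc \<Longrightarrow> (\<And>w. norm w \<le> (1 + \<rho>) / 2 \<Longrightarrow> norm (f w) < \<delta>)
    \<Longrightarrow> dil \<rho> f \<in> zyg \<beta> \<and> zyg_norm \<beta> (dil \<rho> f) \<le> A * \<delta>"
proof -
  define t where "t = (1 + \<rho>) / 2"
  have t: "\<rho> < t" "t < 1" using \<rho> by (auto simp: t_def)
  define c where "c = 1 + 1 / (t - \<rho>) + 2 / (t - \<rho>) ^ 2"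
  have c: "1 \<le> c" "1 / (t - \<rho>) \<le> c" "2 / (t - \<rho>) ^ 2 \<le> c"
    using t by (auto simp: c_def)
  obtain B where B: "B \<ge> 0" "\<And>z. z \<in> disc \<Longrightarrow> wt \<beta> z * norm (deriv (deriv u) z) \<le> B"
    "\<And>z. z \<in> disc \<Longrightarrow> wt \<beta> z * norm (coeff1 u \<phi> z) \<le> B"
    "\<And>z. z \<in> disc \<Longrightarrow> wt \<beta> z * norm (coeff2 u \<phi> z) \<le> B"
    using coeffs_bounded by blast
  define A0 where "A0 = norm (u 0) + norm (deriv u 0) + norm (u 0 * deriv \<phi> 0)"
  have A0: "A0 \<ge> 0" by (simp add: A0_def)
  show thesis
  proof (rule that[of "(A0 + 3 * B) * c"])
    fix f \<delta> assume f: "f holomorphic_on disc" and bd: "\<And>w. norm w \<le> (1 + \<rho>) / 2 \<Longrightarrow> norm (f w) < \<delta>"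
    have d: "\<delta> > 0" using bd[of 0] norm_ge_zero[of "f 0"] \<rho> by (simp add: le_less_trans[OF norm_ge_zero])
    let ?F = "\<lambda>w. f (of_real \<rho> * w)"
    note D = dilation_deriv[OF f \<rho>(1) less_imp_le[OF \<rho>(2)]]
    have bds: "norm (?F w) \<le> c * \<delta>" "norm (deriv ?F w) \<le> c * \<delta>" "norm (deriv (deriv ?F) w) \<le> c * \<delta>"
      if w: "w \<in> disc" for w
    proof -
      have le: "norm (of_real \<rho> * w) \<le> \<rho>"
        using \<rho> w by (simp add: norm_mult mult_left_le)
      have "norm (?F w) \<le> 1 * \<delta>" using bd[of "of_real \<rho> * w"] le t by (simp add: t_def)
      also have "\<dots> \<le> c * \<delta>" using c d by (intro mult_right_mono) auto
      finally show "norm (?F w) \<le> c * \<delta>" .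
      note C = cauchy_deriv_bounds[OF f t le bd[folded t_def]]
      have "norm (deriv ?F w) \<le> 1 * norm (deriv f (of_real \<rho> * w))"
        unfolding D(2)[OF w] norm_mult using \<rho> by (intro mult_right_mono) auto
      also have "\<dots> \<le> 1 / (t - \<rho>) * \<delta>" using C(1) by simp
      also have "\<dots> \<le> c * \<delta>" using c d by (intro mult_right_mono) auto
      finally show "norm (deriv ?F w) \<le> c * \<delta>" .
      have "norm (deriv (deriv ?F) w) \<le> 1 * norm (deriv (deriv f) (of_real \<rho> * w))"
        unfolding D(3)[OF w] norm_mult norm_power using \<rho> by (intro mult_right_mono) (auto simp: power_le_one)
      also have "\<dots> \<le> 2 / (t - \<rho>) ^ 2 * \<delta>" using C(2) by simp
      also have "\<dots> \<le> c * \<delta>" using c d by (intro mult_right_mono) auto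
      finally show "norm (deriv (deriv ?F) w) \<le> c * \<delta>" .
    qed
    have pt: "wt \<beta> z * norm (deriv (deriv (wcomp u \<phi> ?F)) z) \<le> 3 * B * (c * \<delta>)" if z: "z \<in> disc" for z
    proof -
      have cd: "c * \<delta> \<ge> 0" using c d by simp
      have "wt \<beta> z * norm (deriv (deriv (wcomp u \<phi> ?F)) z) \<le> wt \<beta> z * norm (deriv (deriv u) z) * (c * \<delta>)
        + wt \<beta> z * norm (coeff1 u \<phi> z) * (c * \<delta>) + wt \<beta> z * norm (coeff2 u \<phi> z) * (c * \<delta>)"
        by (rule wcomp_deriv2_bound[OF D(1) z bds[OF phi_in[OF z]]])
      also have "\<dots> \<le> B * (c * \<delta>) + B * (c * \<delta>) + B * (c * \<delta>)"
        using B(2-4)[OF z] cd by (intro add_mono mult_right_mono)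
      finally show ?thesis by (simp add: mult_ac)
    qed
    have p0: "\<phi> 0 \<in> disc" by (rule phi_in) simp
    show "dil \<rho> f \<in> zyg \<beta> \<and> zyg_norm \<beta> (dil \<rho> f) \<le> (A0 + 3 * B) * c * \<delta>"
      using wcomp_zyg_norm_le[OF D(1) bds(1,2)[OF p0] pt] unfolding dil_def A0_def
      by (simp add: algebra_simps)
  qed (use A0 B c in auto)
qed

lemma bounded_on_cball:
  assumes "f holomorphic_on disc" "t < 1"
  obtains \<delta> where "\<And>w. norm w \<le> t \<Longrightarrow> norm (f w) < (\<delta>::real)"
proof -
  have "continuous_on (cball 0 t) f"
    using assms
    by (intro holomorphic_on_imp_continuous_on holomorphic_on_subset[OF assms(1)]) auto
  then have "bounded (f ` cball 0 t)"
    using compact_continuous_image compact_imp_bounded compact_cball by blast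
  then obtain b where "\<forall>w\<in>cball 0 t. norm (f w) \<le> b"
    by (auto simp: bounded_iff)
  then have "norm (f w) < b + 1" if "norm w \<le> t" for w
    using that by (simp add: le_less_trans[of _ b])
  then show thesis by (rule that)
qed

text \<open>The growth bound makes the Bloch unit ball a normal family. Montel gives locally uniform
  convergence of a subsequence, and \<open>dil_norm_le\<close> turns this into convergence in the
  Zygmund norm.\<close>

lemma dil_compact:
  assumes \<rho>: "0 \<le> \<rho>" "\<rho> < 1"
  shows "compact_BZ \<beta> (dil \<rho>)"
  unfolding compact_BZ_def
proof (intro conjI allI impI ballI)
  define t where "t = (1 + \<rho>) / 2"
  have t: "\<rho> < t" "t < 1" using \<rho> by (auto simp: t_def)
  obtain A where A: "A \<ge> 0" "\<And>f \<delta>. f holomorphic_on disc \<Longrightarrow> (\<And>w. norm w \<le> t \<Longrightarrow> norm (f w) < \<delta>)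
    \<Longrightarrow> dil \<rho> f \<in> zyg \<beta> \<and> zyg_norm \<beta> (dil \<rho> f) \<le> A * \<delta>"
    using dil_norm_le[OF \<rho>] unfolding t_def by blast
  have dz: "dil \<rho> f \<in> zyg \<beta>" if f: "f holomorphic_on disc" for f
  proof -
    obtain \<delta> where "\<And>w. norm w \<le> t \<Longrightarrow> norm (f w) < \<delta>"
      using bounded_on_cball[OF f t(2)] by blast
    from A(2)[OF f this] show ?thesis by simp
  qed
  show "linear_BZ (dil \<rho>)"
    by (simp add: linear_BZ_def dil_def wcomp_def algebra_simps)
  show "dil \<rho> f \<in> zyg \<beta>" if "f \<in> bloch" for f
    using that dz by (simp add: bloch_def)
  fix s :: "nat \<Rightarrow> complex \<Rightarrow> complex"
  assume s: "\<forall>n. s n \<in> bloch \<and> bloch_norm (s n) \<le> 1"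
  let ?H = "{f \<in> bloch. bloch_norm f \<le> 1}"
  have bdK: "\<exists>B. \<forall>h\<in>?H. \<forall>z\<in>K. norm (h z) \<le> B" if K: "compact K" "K \<subseteq> disc" for K
  proof -
    have "continuous_on K (\<lambda>w. 1 - ln (1 - norm w))"
      using K(2) by (intro continuous_intros) auto
    then have "bounded ((\<lambda>w. 1 - ln (1 - norm w)) ` K)"
      using K compact_continuous_image compact_imp_bounded by blast
    then obtain B where B: "\<And>w. w \<in> K \<Longrightarrow> \<bar>1 - ln (1 - norm w)\<bar> \<le> B"
      by (auto simp: bounded_iff)
    show ?thesis
    proof (intro exI ballI)
      fix h z assume "h \<in> ?H" "z \<in> K"
      then show "norm (h z) \<le> B"
        using bloch_unit_growth[of h z] B[of z] subsetD[OF K(2), of z] by (simp add: abs_le_iff)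
    qed
  qed
  obtain g r where g: "g holomorphic_on disc" and r: "strict_mono (r :: nat \<Rightarrow> nat)"
    and unif: "\<And>K. compact K \<Longrightarrow> K \<subseteq> disc \<Longrightarrow> uniform_limit K (s \<circ> r) g sequentially"
  proof (rule Montel[of disc ?H s])
    show "range s \<subseteq> ?H" using s by auto
  qed (use bdK in \<open>auto simp: bloch_def\<close>)
  have sh: "s n holomorphic_on disc" for n using s by (simp add: bloch_def)
  have "(\<lambda>n. zyg_norm \<beta> (\<lambda>z. dil \<rho> (s (r n)) z - dil \<rho> g z)) \<longlonglongrightarrow> 0"
  proof (rule metric_LIMSEQ_I)
    fix e :: real assume e: "e > 0"
    have "uniform_limit (cball 0 t) (s \<circ> r) g sequentially"
      using t by (intro unif) auto
    then have "\<forall>\<^sub>F n in sequentially. \<forall>w\<in>cball 0 t. dist ((s \<circ> r) n w) (g w) < e / (A + 1)"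
      using e A(1) unfolding uniform_limit_iff by auto
    then obtain N where "\<forall>n\<ge>N. \<forall>w\<in>cball 0 t. dist ((s \<circ> r) n w) (g w) < e / (A + 1)"
      unfolding eventually_sequentially by (elim exE)
    then have N: "norm (s (r n) w - g w) < e / (A + 1)" if "n \<ge> N" "norm w \<le> t" for n w
      using that by (simp add: dist_norm)
    show "\<exists>N. \<forall>n\<ge>N. dist (zyg_norm \<beta> (\<lambda>z. dil \<rho> (s (r n)) z - dil \<rho> g z)) 0 < e"
    proof (intro exI[of _ N] allI impI)
      fix n assume n: "n \<ge> N"
      let ?d = "\<lambda>w. s (r n) w - g w"
      have eq: "(\<lambda>z. dil \<rho> (s (r n)) z - dil \<rho> g z) = dil \<rho> ?d"
        by (simp add: dil_def wcomp_def algebra_simps fun_eq_iff)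
      have "dil \<rho> ?d \<in> zyg \<beta> \<and> zyg_norm \<beta> (dil \<rho> ?d) \<le> A * (e / (A + 1))"
        using N[OF n] by (intro A(2) holomorphic_intros sh g)
      moreover have "A * (e / (A + 1)) < e"
        using A(1) e by (simp add: field_simps)
      ultimately show "dist (zyg_norm \<beta> (\<lambda>z. dil \<rho> (s (r n)) z - dil \<rho> g z)) 0 < e"
        unfolding eq using zyg_norm_nonneg[of "dil \<rho> ?d" \<beta>] by auto
    qed
  qed
  then show "\<exists>r g. strict_mono r \<and> g \<in> zyg \<beta> \<and> (\<lambda>n. zyg_norm \<beta> (\<lambda>z. dil \<rho> (s (r n)) z - g z)) \<longlonglongrightarrow> 0"
    using r dz[OF g] by blast
qed

text \<open>The constant is 84 = 2 * 6 + 2 * 4 + 8 * 8: the factors 2, 2, 8 bound f - f(\<rho> .)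
  and its two derivatives, while 6, 4, 8 come from the hypotheses.\<close>

lemma ess_upper:
  assumes s0: "s0 < 1"
    and U: "\<And>z. z \<in> disc \<Longrightarrow> s0 < norm (\<phi> z) \<Longrightarrow> wt \<beta> z * norm (deriv (deriv u) z) * (1 - ln (1 - norm (\<phi> z))) \<le> 6 * L"
    and V: "\<And>z. z \<in> disc \<Longrightarrow> s0 < norm (\<phi> z) \<Longrightarrow> wt \<beta> z * norm (coeff1 u \<phi> z) / (1 - norm (\<phi> z)) \<le> 4 * L"
    and H: "\<And>z. z \<in> disc \<Longrightarrow> s0 < norm (\<phi> z) \<Longrightarrow> wt \<beta> z * norm (coeff2 u \<phi> z) / (1 - norm (\<phi> z)) ^ 2 \<le> 8 * L"
    and L: "L \<ge> 0"
  shows "ess \<le> 84 * L"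
proof (rule field_le_epsilon)
  fix d :: real assume d: "d > 0"
  \<comment> \<open>Including |\<phi>(0)| puts \<phi>(0) into the region of smallness, as the two
    values at 0 in the Zygmund norm require.\<close>
  define s where "s = max s0 (norm (\<phi> 0))"
  have s: "s < 1" "s0 \<le> s" "norm (\<phi> 0) \<le> s" "0 \<le> s"
    using s0 phi_norm[of 0] by (simp_all add: s_def le_max_iff_disj)
  define t where "t = (1 + s) / 2"
  have t: "s < t" "t < 1" using s by (auto simp: t_def)
  define c where "c = 1 + 1 / (t - s) + 2 / (t - s) ^ 2"
  have c: "1 \<le> c" "1 / (t - s) \<le> c" "2 / (t - s) ^ 2 \<le> c"
    using t by (auto simp: c_def)
  obtain B where B: "B \<ge> 0" "\<And>z. z \<in> disc \<Longrightarrow> wt \<beta> z * norm (deriv (deriv u) z) \<le> B"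
    "\<And>z. z \<in> disc \<Longrightarrow> wt \<beta> z * norm (coeff1 u \<phi> z) \<le> B"
    "\<And>z. z \<in> disc \<Longrightarrow> wt \<beta> z * norm (coeff2 u \<phi> z) \<le> B"
    using coeffs_bounded by blast
  define A0 where "A0 = norm (u 0) + norm (deriv u 0) + norm (u 0 * deriv \<phi> 0)"
  have A0: "A0 \<ge> 0" by (simp add: A0_def)
  define Q where "Q = 2 / (1 - t) * c * (A0 + 3 * B + 1)"
  have Q: "Q > 0" unfolding Q_def using t c A0 B by (intro mult_pos_pos) auto
  \<comment> \<open>Q is arranged so that (A0 + 3B) c \<delta> \<le> \<eta> Q \<le> d: the total
    error from |\<phi>(z)| \<le> s and from the values at 0.\<close>
  define \<eta> where "\<eta> = min (1 / 2) (d / Q)"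
  have \<eta>: "0 < \<eta>" "\<eta> \<le> 1 / 2" "\<eta> * Q \<le> d"
    using Q d by (auto simp: \<eta>_def min_def field_simps)
  define \<rho> where "\<rho> = 1 - \<eta>"
  have \<rho>: "0 \<le> \<rho>" "\<rho> < 1" using \<eta> by (auto simp: \<rho>_def)
  \<comment> \<open>The mean value inequality gives \<eta>/(1-t) for f(w) - f(\<rho> w) on |w| \<le>
    t; doubling makes the bound strict.\<close>
  define \<delta> where "\<delta> = 2 * \<eta> / (1 - t)"
  have \<delta>: "\<delta> > 0" using \<eta> t by (simp add: \<delta>_def)
  have small: "(A0 + 3 * B) * (c * \<delta>) \<le> d"
  proof -
    have "(A0 + 3 * B) * (c * \<delta>) \<le> (A0 + 3 * B + 1) * (c * \<delta>)"
      using c \<delta> by (intro mult_right_mono) auto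
    also have "\<dots> = \<eta> * Q" by (simp add: Q_def \<delta>_def)
    finally show ?thesis using \<eta>(3) by simp
  qed
  have main: "zyg_norm \<beta> (\<lambda>z. wcomp u \<phi> f z - dil \<rho> f z) \<le> 84 * L + d"
    if f: "f \<in> bloch" "bloch_norm f \<le> 1" for f
  proof -
    define F where "F = (\<lambda>w. f w - f (of_real \<rho> * w))"
    have fh: "f holomorphic_on disc" using f by (simp add: bloch_def)
    note D = dilation_deriv[OF fh \<rho>(1) less_imp_le[OF \<rho>(2)]]
    have Fh: "F holomorphic_on disc"
      unfolding F_def by (intro holomorphic_intros fh D(1))
    have eq: "(\<lambda>z. wcomp u \<phi> f z - dil \<rho> f z) = wcomp u \<phi> F"
      by (simp add: F_def wcomp_def dil_def algebra_simps fun_eq_iff)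
    have dF: "deriv F w = deriv f w - of_real \<rho> * deriv f (of_real \<rho> * w)"
      "deriv (deriv F) w = deriv (deriv f) w - of_real \<rho> ^ 2 * deriv (deriv f) (of_real \<rho> * w)"
      if "w \<in> disc" for w
      using deriv_lin[OF fh D(1) that, of 1 "-1"] deriv2_lin[OF fh D(1) that, of 1 "-1"] D(2,3)[OF that]
      by (simp_all add: F_def)
    have dil_le: "norm (of_real \<rho> * w) \<le> norm w" for w :: complex
      using \<rho> by (simp add: norm_mult mult_left_le_one_le)
    have Fsmall: "norm (F w) < \<delta>" if w: "norm w \<le> t" for w
    proof -
      have "norm (f w - f (of_real \<rho> * w)) \<le> 1 / (1 - t) * norm (w - of_real \<rho> * w)"
      proof (rule field_differentiable_bound[of "cball 0 t" f "deriv f"])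
        fix z :: complex assume z: "z \<in> cball 0 t"
        then have zd: "z \<in> disc" using t by simp
        show "(f has_field_derivative deriv f z) (at z within cball 0 t)"
          using has_deriv_disc[OF fh zd] has_field_derivative_at_within by blast
        show "norm (deriv f z) \<le> 1 / (1 - t)"
          by (rule order_trans[OF bloch_unit_deriv_le[OF f zd]]) (use z t in \<open>auto intro!: divide_left_mono\<close>)
      qed (use w dil_le[of w] in auto)
      also have "w - of_real \<rho> * w = of_real \<eta> * w"
        by (simp add: \<rho>_def algebra_simps)
      also have "1 / (1 - t) * norm (of_real \<eta> * w) \<le> 1 / (1 - t) * (\<eta> * 1)"
        unfolding norm_mult using \<eta> t w by (intro mult_left_mono mult_mono) auto
      also have "\<dots> < \<delta>"
        using \<eta> t by (simp add: \<delta>_def field_simps)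
      finally show ?thesis by (simp add: F_def)
    qed
    have near: "norm (F w) \<le> c * \<delta>" "norm (deriv F w) \<le> c * \<delta>" "norm (deriv (deriv F) w) \<le> c * \<delta>"
      if w: "norm w \<le> s" for w
    proof -
      have "norm (F w) \<le> 1 * \<delta>" using Fsmall[of w] w t by simp
      also have "\<dots> \<le> c * \<delta>" using c \<delta> by (intro mult_right_mono) auto
      finally show "norm (F w) \<le> c * \<delta>" .
      note C = cauchy_deriv_bounds[OF Fh t w Fsmall]
      have "norm (deriv F w) \<le> 1 / (t - s) * \<delta>" using C(1) by simp
      also have "\<dots> \<le> c * \<delta>" using c \<delta> by (intro mult_right_mono) auto
      finally show "norm (deriv F w) \<le> c * \<delta>" .
      have "norm (deriv (deriv F) w) \<le> 2 / (t - s) ^ 2 * \<delta>" using C(2) by simp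
      also have "\<dots> \<le> c * \<delta>" using c \<delta> by (intro mult_right_mono) auto
      finally show "norm (deriv (deriv F) w) \<le> c * \<delta>" .
    qed
    \<comment> \<open>Near the circle the difference need not be small. The function and its
      dilation are bounded separately, which doubles the constants 1, 1 and 4 of the unit
      ball.\<close>
    have far: "norm (F w) \<le> 2 * (1 - ln (1 - norm w))" "norm (deriv F w) \<le> 2 / (1 - norm w)"
      "norm (deriv (deriv F) w) \<le> 8 / (1 - norm w) ^ 2" if w: "w \<in> disc" for w
    proof -
      define v where "v = of_real \<rho> * w"
      have v: "norm v \<le> norm w" "v \<in> disc"
        using dil_le[of w] w by (auto simp: v_def)
      have w1: "norm w < 1" using w by simp
      have "norm (f v) \<le> 1 - ln (1 - norm v)" using bloch_unit_growth[OF f v(2)] .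
      also have "\<dots> \<le> 1 - ln (1 - norm w)" using v(1) w1 by simp
      finally have "norm (f w) + norm (f v) \<le> (1 - ln (1 - norm w)) + (1 - ln (1 - norm w))"
        by (intro add_mono bloch_unit_growth[OF f w])
      with norm_triangle_ineq4[of "f w" "f v"] show "norm (F w) \<le> 2 * (1 - ln (1 - norm w))"
        unfolding F_def v_def mult_2 by (rule order_trans)
      have "norm (of_real \<rho> * deriv f v) \<le> 1 * norm (deriv f v)"
        unfolding norm_mult using \<rho> by (intro mult_right_mono) auto
      also have "\<dots> \<le> 1 / (1 - norm v)" using bloch_unit_deriv_le[OF f v(2)] by simp
      also have "\<dots> \<le> 1 / (1 - norm w)" using v(1) w1 by (intro divide_left_mono) auto
      finally have 1: "norm (of_real \<rho> * deriv f v) \<le> 1 / (1 - norm w)" .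
      show "norm (deriv F w) \<le> 2 / (1 - norm w)"
        using 1 bloch_unit_deriv_le[OF f w] norm_triangle_ineq4[of "deriv f w" "of_real \<rho> * deriv f v"]
        unfolding dF(1)[OF w] v_def by simp
      have "norm (of_real \<rho> ^ 2 * deriv (deriv f) v) \<le> 1 * norm (deriv (deriv f) v)"
        unfolding norm_mult norm_power using \<rho> by (intro mult_right_mono) (auto simp: power_le_one)
      also have "\<dots> \<le> 4 / (1 - norm v) ^ 2" using bloch_unit_deriv2_le[OF f v(2)] by simp
      also have "\<dots> \<le> 4 / (1 - norm w) ^ 2" using v(1) w1 by (intro divide_left_mono power_mono) auto
      finally have 2: "norm (of_real \<rho> ^ 2 * deriv (deriv f) v) \<le> 4 / (1 - norm w) ^ 2" .
      show "norm (deriv (deriv F) w) \<le> 8 / (1 - norm w) ^ 2"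
        using 2 bloch_unit_deriv2_le[OF f w] norm_triangle_ineq4[of "deriv (deriv f) w" "of_real \<rho> ^ 2 * deriv (deriv f) v"]
        unfolding dF(2)[OF w] v_def by simp
    qed
    have cd: "c * \<delta> \<ge> 0" using c \<delta> by simp
    have pt: "wt \<beta> z * norm (deriv (deriv (wcomp u \<phi> F)) z) \<le> 3 * B * (c * \<delta>) + 84 * L" if z: "z \<in> disc" for z
    proof (cases "norm (\<phi> z) \<le> s")
      case True
      have "wt \<beta> z * norm (deriv (deriv (wcomp u \<phi> F)) z) \<le> wt \<beta> z * norm (deriv (deriv u) z) * (c * \<delta>)
        + wt \<beta> z * norm (coeff1 u \<phi> z) * (c * \<delta>) + wt \<beta> z * norm (coeff2 u \<phi> z) * (c * \<delta>)"
        by (rule wcomp_deriv2_bound[OF Fh z near[OF True]])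
      also have "\<dots> \<le> B * (c * \<delta>) + B * (c * \<delta>) + B * (c * \<delta>)"
        using B(2-4)[OF z] cd by (intro add_mono mult_right_mono)
      finally show ?thesis using L by (simp add: mult_ac)
    next
      case False
      then have gt: "s0 < norm (\<phi> z)" using s by simp
      let ?x = "norm (\<phi> z)"
      have "wt \<beta> z * norm (deriv (deriv (wcomp u \<phi> F)) z) \<le> wt \<beta> z * norm (deriv (deriv u) z) * (2 * (1 - ln (1 - ?x)))
        + wt \<beta> z * norm (coeff1 u \<phi> z) * (2 / (1 - ?x)) + wt \<beta> z * norm (coeff2 u \<phi> z) * (8 / (1 - ?x) ^ 2)"
        by (rule wcomp_deriv2_bound[OF Fh z far[OF phi_in[OF z]]])
      also have "\<dots> = 2 * (wt \<beta> z * norm (deriv (deriv u) z) * (1 - ln (1 - ?x)))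
        + 2 * (wt \<beta> z * norm (coeff1 u \<phi> z) / (1 - ?x)) + 8 * (wt \<beta> z * norm (coeff2 u \<phi> z) / (1 - ?x) ^ 2)"
        by (simp add: algebra_simps)
      also have "\<dots> \<le> 2 * (6 * L) + 2 * (4 * L) + 8 * (8 * L)"
        using U[OF z gt] V[OF z gt] H[OF z gt] by (intro add_mono mult_left_mono) auto
      also have "\<dots> \<le> 3 * B * (c * \<delta>) + 84 * L"
        using B(1) cd by simp
      finally show ?thesis .
    qed
    have "zyg_norm \<beta> (wcomp u \<phi> F) \<le> A0 * (c * \<delta>) + (3 * B * (c * \<delta>) + 84 * L)"
      unfolding A0_def by (rule wcomp_zyg_norm_le(2)[OF Fh near(1,2)[OF s(3)] pt])
    also have "\<dots> = (A0 + 3 * B) * (c * \<delta>) + 84 * L"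
      by (simp add: algebra_simps)
    finally show ?thesis using small unfolding eq by simp
  qed
  have "opnorm_BZ \<beta> (\<lambda>f z. wcomp u \<phi> f z - dil \<rho> f z) \<le> 84 * L + d"
    unfolding opnorm_BZ_def by (rule cSUP_least) (use zero_in_bloch main in auto)
  then show "ess \<le> 84 * L + d"
    using ess_le[OF dil_compact[OF \<rho>]] by linarith
qed

section \<open>Comparison of the essential norm with the limsups\<close>

lemma ess_le_limsups:
  assumes V: "limsup (\<lambda>n. ereal (real n + 1) * nu_norm \<beta> (\<lambda>z. coeff1 u \<phi> z * \<phi> z ^ n)) < ereal L"
    and H: "limsup (\<lambda>n. ereal ((real n + 1) ^ 2) * nu_norm \<beta> (\<lambda>z. coeff2 u \<phi> z * \<phi> z ^ n)) < ereal L"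
    and U: "limsup (\<lambda>n. ereal (ln (real n)) * nu_norm \<beta> (\<lambda>z. deriv (deriv u) z * \<phi> z ^ n)) < ereal L"
  shows "ess \<le> 84 * L"
proof -
  have lnn: "0 \<le> ln (real n)" for n
    by (cases "n = 0") auto
  have "\<forall>\<^sub>F n in sequentially.
     (\<forall>z\<in>disc. (real n + 1) * norm (\<phi> z) ^ n * (wt \<beta> z * norm (coeff1 u \<phi> z)) \<le> L) \<and>
     (\<forall>z\<in>disc. (real n + 1) ^ 2 * norm (\<phi> z) ^ n * (wt \<beta> z * norm (coeff2 u \<phi> z)) \<le> L) \<and>
     (\<forall>z\<in>disc. ln (real n) * norm (\<phi> z) ^ n * (wt \<beta> z * norm (deriv (deriv u) z)) \<le> L)"
    using lnn by (intro eventually_conj limsup_nu_norm_pointwise V H U) auto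
  then obtain N where N: "\<And>n z. n \<ge> N \<Longrightarrow> z \<in> disc \<Longrightarrow> (real n + 1) * norm (\<phi> z) ^ n * (wt \<beta> z * norm (coeff1 u \<phi> z)) \<le> L"
     "\<And>n z. n \<ge> N \<Longrightarrow> z \<in> disc \<Longrightarrow> (real n + 1) ^ 2 * norm (\<phi> z) ^ n * (wt \<beta> z * norm (coeff2 u \<phi> z)) \<le> L"
     "\<And>n z. n \<ge> N \<Longrightarrow> z \<in> disc \<Longrightarrow> ln (real n) * norm (\<phi> z) ^ n * (wt \<beta> z * norm (deriv (deriv u) z)) \<le> L"
    unfolding eventually_sequentially by blast
  have L: "0 \<le> L"
    by (rule order_trans[OF _ N(1)[of N 0]]) auto
  \<comment> \<open>Exactly the threshold beyond which \<open>power_choice\<close> delivers an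
    exponent n \<ge> N.\<close>
  let ?s = "1 - 1 / (2 * (real N + 3))"
  have "wt \<beta> z * norm (deriv (deriv u) z) * (1 - ln (1 - norm (\<phi> z))) \<le> 6 * L \<and>
    wt \<beta> z * norm (coeff1 u \<phi> z) / (1 - norm (\<phi> z)) \<le> 4 * L \<and>
    wt \<beta> z * norm (coeff2 u \<phi> z) / (1 - norm (\<phi> z)) ^ 2 \<le> 8 * L"
    if z: "z \<in> disc" and gt: "?s < norm (\<phi> z)" for z
  proof -
    define x where "x = norm (\<phi> z)"
    have x: "0 \<le> x" "x < 1" "?s \<le> x" using phi_norm[OF z] gt by (auto simp: x_def)
    obtain n where n: "n \<ge> N" "n \<ge> 3" "x ^ n \<ge> 1 / 2" "1 / (1 - x) \<le> 2 * (real n + 1)"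
      using power_choice[OF x] .
    \<comment> \<open>Dropping x^n \<ge> 1/2 costs a factor 2, and k compares the growth weight q
      with the power weight q'. With k = 3, 2, 4 this gives the 6, 4, 8 of
      \<open>ess_upper\<close>.\<close>
    have absorb: "P * q \<le> 2 * k * L" if "0 \<le> P" "0 \<le> q'" "q \<le> k * q'" "0 \<le> k" "q' * x ^ n * P \<le> L" for P q q' k :: real
    proof -
      have "P * q \<le> P * (k * q')" using that by (intro mult_left_mono) auto
      also have "\<dots> = 2 * k * (q' * (1 / 2) * P)" by simp
      also have "\<dots> \<le> 2 * k * (q' * x ^ n * P)"
        using that n(3) by (intro mult_left_mono mult_right_mono) auto
      also have "\<dots> \<le> 2 * k * L" using that by (intro mult_left_mono) auto
      finally show ?thesis .
    qed
    have "(wt \<beta> z * norm (deriv (deriv u) z)) * (1 - ln (1 - x)) \<le> 2 * 3 * L"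
      using log_choice[OF x(1,2) n(2,4)] lnn N(3)[OF n(1) z] by (intro absorb[of _ "ln (real n)"]) (auto simp: x_def)
    moreover have "(wt \<beta> z * norm (coeff1 u \<phi> z)) * (1 / (1 - x)) \<le> 2 * 2 * L"
      using n(4) N(1)[OF n(1) z] by (intro absorb[of _ "real n + 1"]) (auto simp: x_def)
    moreover have "(wt \<beta> z * norm (coeff2 u \<phi> z)) * (1 / (1 - x)) ^ 2 \<le> 2 * 4 * L"
    proof (rule absorb[of _ "(real n + 1) ^ 2"])
      have "(1 / (1 - x)) ^ 2 \<le> (2 * (real n + 1)) ^ 2"
        using x by (intro power_mono n(4)) auto
      then show "(1 / (1 - x)) ^ 2 \<le> 4 * (real n + 1) ^ 2"
        unfolding power_mult_distrib by simp
    qed (use N(2)[OF n(1) z] in \<open>auto simp: x_def\<close>)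
    ultimately show ?thesis by (simp add: x_def power_divide)
  qed
  then show ?thesis
    by (intro ess_upper[of ?s] L) auto
qed

lemma limsups_le_ess:
  assumes e: "e > 0"
  shows "limsup (\<lambda>n. ereal (real n + 1) * nu_norm \<beta> (\<lambda>z. coeff1 u \<phi> z * \<phi> z ^ n)) \<le> ereal (224000 * (ess + e) + e)"
    "limsup (\<lambda>n. ereal ((real n + 1) ^ 2) * nu_norm \<beta> (\<lambda>z. coeff2 u \<phi> z * \<phi> z ^ n)) \<le> ereal (224000 * (ess + e) + e)"
    "limsup (\<lambda>n. ereal (ln (real n)) * nu_norm \<beta> (\<lambda>z. deriv (deriv u) z * \<phi> z ^ n)) \<le> ereal (224000 * (ess + e) + e)"
proof -
  obtain s where s: "s < 1" and low: "\<And>z. z \<in> disc \<Longrightarrow> s < norm (\<phi> z) \<Longrightarrow>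
     wt \<beta> z * norm (coeff2 u \<phi> z) / (1 - norm (\<phi> z) ^ 2) ^ 2 \<le> 14000 * (ess + e) \<and>
     wt \<beta> z * norm (coeff1 u \<phi> z) / (1 - norm (\<phi> z) ^ 2) \<le> 14000 * (ess + e) \<and>
     wt \<beta> z * norm (deriv (deriv u) z) * lgw (\<phi> z) \<le> 14000 * (ess + e)"
    using ess_lower[OF e] by blast
  obtain B where "B \<ge> 0" and B: "\<And>z. z \<in> disc \<Longrightarrow> wt \<beta> z * norm (deriv (deriv u) z) \<le> B"
    "\<And>z. z \<in> disc \<Longrightarrow> wt \<beta> z * norm (coeff1 u \<phi> z) \<le> B"
    "\<And>z. z \<in> disc \<Longrightarrow> wt \<beta> z * norm (coeff2 u \<phi> z) \<le> B"
    using coeffs_bounded by blast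
  define E where "E = ess + e"
  have E: "E > 0" using ess_nonneg e by (simp add: E_def)
  \<comment> \<open>The elementary inequalities bound p q by 2, 16 and 2 in the three cases. Taking
    16 for all gives 224000 = 16 * 14000.\<close>
  have transfer: "p * P \<le> 224000 * E" if "p * q \<le> 16" "P / q \<le> 14000 * E" "q > 0" "0 \<le> p" "0 \<le> P" for p q P :: real
  proof -
    have "p * P = (p * q) * (P / q)" using that(3) by simp
    also have "\<dots> \<le> 16 * (14000 * E)" using that E by (intro mult_mono) auto
    finally show ?thesis by simp
  qed
  have q: "0 < 1 - norm (\<phi> z) ^ 2" if "z \<in> disc" for z
    using one_minus_sq_pos[OF phi_in[OF that]] .
  have sq: "real n + 1 \<le> (real n + 1) ^ 2" for n
    by (simp add: power2_eq_square)
  have lnn: "0 \<le> ln (real n)" "ln (real n) \<le> (real n + 1) ^ 2" for n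
  proof -
    show "0 \<le> ln (real n)" by (cases "n = 0") auto
    have "ln (real n) \<le> real n"
      using ln_le_minus_one[of "real n"] by (cases "n = 0") auto
    then show "ln (real n) \<le> (real n + 1) ^ 2" using sq[of n] by linarith
  qed
  have L0: "224000 * (ess + e) \<ge> 0" using E by (simp add: E_def)
  show "limsup (\<lambda>n. ereal (real n + 1) * nu_norm \<beta> (\<lambda>z. coeff1 u \<phi> z * \<phi> z ^ n)) \<le> ereal (224000 * (ess + e) + e)"
  proof (rule limsup_nu_norm_le[OF B(2) _ sq s e L0])
    fix n z assume z: "z \<in> disc" "s < norm (\<phi> z)"
    let ?x = "norm (\<phi> z)"
    have "((real n + 1) * ?x ^ n) * (1 - ?x ^ 2) \<le> ((real n + 1) * ?x ^ n) * (2 * (1 - ?x))"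
      using one_minus_sq_le[of ?x] phi_norm[OF z(1)] by (intro mult_left_mono) auto
    also have "\<dots> = 2 * ((real n + 1) * ?x ^ n * (1 - ?x))" by (simp only: mult_ac)
    also have "\<dots> \<le> 2 * 1"
      using power_mult_one_minus_le[of ?x n] phi_norm[OF z(1)] by (intro mult_left_mono) auto
    finally show "(real n + 1) * ?x ^ n * (wt \<beta> z * norm (coeff1 u \<phi> z)) \<le> 224000 * (ess + e)"
      using low[OF z] q[OF z(1)] unfolding E_def[symmetric] by (intro transfer[of _ "1 - ?x ^ 2"]) auto
  qed auto
  show "limsup (\<lambda>n. ereal ((real n + 1) ^ 2) * nu_norm \<beta> (\<lambda>z. coeff2 u \<phi> z * \<phi> z ^ n)) \<le> ereal (224000 * (ess + e) + e)"
  proof (rule limsup_nu_norm_le[OF B(3) _ order_refl s e L0])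
    fix n z assume z: "z \<in> disc" "s < norm (\<phi> z)"
    let ?x = "norm (\<phi> z)"
    show "(real n + 1) ^ 2 * ?x ^ n * (wt \<beta> z * norm (coeff2 u \<phi> z)) \<le> 224000 * (ess + e)"
      using power_mult_one_minus_sq_le[of ?x n] phi_norm[OF z(1)] low[OF z] q[OF z(1)]
      unfolding E_def[symmetric] by (intro transfer[of _ "(1 - ?x ^ 2) ^ 2"]) auto
  qed auto
  show "limsup (\<lambda>n. ereal (ln (real n)) * nu_norm \<beta> (\<lambda>z. deriv (deriv u) z * \<phi> z ^ n)) \<le> ereal (224000 * (ess + e) + e)"
  proof (rule limsup_nu_norm_le[OF B(1) lnn s e L0])
    fix n z assume z: "z \<in> disc" "s < norm (\<phi> z)"
    let ?x = "norm (\<phi> z)"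
    have l: "lgw (\<phi> z) \<ge> 1" using lgw_ge[OF phi_in[OF z(1)]] .
    show "ln (real n) * ?x ^ n * (wt \<beta> z * norm (deriv (deriv u) z)) \<le> 224000 * (ess + e)"
      unfolding E_def[symmetric]
    proof (rule transfer[of _ "1 / lgw (\<phi> z)"])
      show "ln (real n) * ?x ^ n * (1 / lgw (\<phi> z)) \<le> 16"
        using ln_mult_power_le[OF phi_in[OF z(1)], of n] l by (simp add: field_simps)
    qed (use l lnn low[OF z] in \<open>auto simp: E_def\<close>)
  qed
qed

end

theorem theorem4p5:
  fixes \<beta> :: real
  assumes "0 < \<beta>"
  shows "\<exists>C>0. \<forall>u \<phi>. u holomorphic_on disc \<longrightarrow> self_map \<phi> \<longrightarrow>
     bounded_BZ \<beta> (wcomp u \<phi>) \<longrightarrow>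
     (let M = max (limsup (\<lambda>n. ereal (real n + 1) *
                     nu_norm \<beta> (\<lambda>z. (2 * deriv u z * deriv \<phi> z + u z * deriv (deriv \<phi>) z) * \<phi> z ^ n)))
                 (max (limsup (\<lambda>n. ereal ((real n + 1) ^ 2) *
                     nu_norm \<beta> (\<lambda>z. u z * (deriv \<phi> z) ^ 2 * \<phi> z ^ n)))
                      (limsup (\<lambda>n. ereal (ln (real n)) *
                     nu_norm \<beta> (\<lambda>z. deriv (deriv u) z * \<phi> z ^ n))));
          E = essnorm_BZ \<beta> (wcomp u \<phi>)
      in ereal (E / C) \<le> M \<and> M \<le> ereal (C * E))"
proof (intro exI[of _ 224000] conjI allI impI)
  fix u \<phi> assume "u holomorphic_on disc" "self_map \<phi>" "bounded_BZ \<beta> (wcomp u \<phi>)"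
  then interpret weighted_composition \<beta> u \<phi>
    by unfold_locales
  define M where "M = max (limsup (\<lambda>n. ereal (real n + 1) * nu_norm \<beta> (\<lambda>z. coeff1 u \<phi> z * \<phi> z ^ n)))
    (max (limsup (\<lambda>n. ereal ((real n + 1) ^ 2) * nu_norm \<beta> (\<lambda>z. coeff2 u \<phi> z * \<phi> z ^ n)))
      (limsup (\<lambda>n. ereal (ln (real n)) * nu_norm \<beta> (\<lambda>z. deriv (deriv u) z * \<phi> z ^ n))))"
  have "ereal (ess / 224000) \<le> M"
  proof (rule ccontr)
    assume "\<not> ?thesis"
    then obtain L where L: "M < ereal L" "ereal L < ereal (ess / 224000)"
      using ereal_dense2[of M "ereal (ess / 224000)"] by (auto simp: not_le)
    \<comment> \<open>Since 84 < 224000, this together with L < ess/224000 would make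
      \<open>ess\<close> negative.\<close>
    then have "ess \<le> 84 * L"
      unfolding M_def by (intro ess_le_limsups) simp_all
    then show False using L(2) ess_nonneg by simp
  qed
  moreover have "M \<le> ereal (224000 * ess)"
  proof (rule ereal_le_epsilon2)
    fix d :: real assume d: "0 < d"
    \<comment> \<open>With this e the two error terms 224000 e and e add up to d.\<close>
    define e where "e = d / 224001"
    have e: "e > 0" "224000 * (ess + e) + e = 224000 * ess + d"
      using d by (auto simp: e_def algebra_simps)
    show "M \<le> ereal (224000 * ess) + ereal d"
      using limsups_le_ess[OF e(1)] unfolding e(2) M_def by simp
  qed
  ultimately show "let M = max (limsup (\<lambda>n. ereal (real n + 1) *
                     nu_norm \<beta> (\<lambda>z. (2 * deriv u z * deriv \<phi> z + u z * deriv (deriv \<phi>) z) * \<phi> z ^ n)))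
                 (max (limsup (\<lambda>n. ereal ((real n + 1) ^ 2) *
                     nu_norm \<beta> (\<lambda>z. u z * (deriv \<phi> z) ^ 2 * \<phi> z ^ n)))
                      (limsup (\<lambda>n. ereal (ln (real n)) *
                     nu_norm \<beta> (\<lambda>z. deriv (deriv u) z * \<phi> z ^ n))));
          E = essnorm_BZ \<beta> (wcomp u \<phi>)
      in ereal (E / 224000) \<le> M \<and> M \<le> ereal (224000 * E)"
    unfolding Let_def M_def coeff1_def coeff2_def by (rule conjI)
qed simp

end
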